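(* Let $1\leq m<n$ be integers. (a) If $F\subseteq\mathbb{R}^n$ is bounded with $\overline{\dim}_{\mathrm B}F\leq m$ and $$\max\{m,\overline{\dim}_{\mathrm B}F\}\ \leq\ \dim_{\mathrm A}F\ <\ \frac{\big(mn+2\,\overline{\dim}_{\mathrm B}F\,(n-m)\big)m}{mn+\overline{\dim}_{\mathrm B}F\,(n-m)},$$ then, for almost all $V\in G(n,m)$, $$\overline{\dim}_{\mathrm B}\,\pi_VF\ \geq\ \overline{\dim}_{\mathrm B}F-\frac{(\dim_{\mathrm A}F-m)\,\overline{\dim}_{\mathrm B}F}{m}\ >\ \frac{\overline{\dim}_{\mathrm B}F}{1+(1/m-1/n)\,\overline{\dim}_{\mathrm B}F}.$$ (b) The result in (a) remains valid for bounded $F\subseteq\mathbb{R}^n$ with $\overline{\dim}_{\mathrm B}$ replaced by $\underline{\dim}_{\mathrm B}$ throughout (in hypotheses and conclusion). (c) If $F\subseteq\mathbb{R}^n$ is Borel, the result in (a) remains valid with $\overline{\dim}_{\mathrm B}$ replaced by $\dim_{\mathrm P}$ (in hypotheses and conclusion).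
   Context: All sets $F$ are non-empty. $G(n,m)$ is the Grassmannian of $m$-dimensional linear subspaces of $\mathbb{R}^n$, "almost all" refers to its natural invariant (rotation-invariant) measure, and $\pi_V:\mathbb{R}^n\to V$ is orthogonal projection onto $V$. For non-empty bounded $E\subseteq\mathbb{R}^n$ and $r>0$, $N_r(E)$ is the minimum number of sets of diameter $r$ (using diameter at most $r$ gives the same dimensions) that can cover $E$. The lower and upper box dimensions are $\underline{\dim}_{\mathrm B}E=\liminf_{r\to0}\frac{\log N_r(E)}{-\log r}$ and $\overline{\dim}_{\mathrm B}E=\limsup_{r\to0}\frac{\log N_r(E)}{-\log r}$. The packing dimension of a (not necessarily bounded) set $F$ is $\dim_{\mathrm P}F=\inf\{\sup_j\overline{\dim}_{\mathrm B}F_j: F\subseteq\bigcup_{j=1}^\infty F_j,\ F_j\text{ compact}\}$. The Assouad dimension $\dim_{\mathrm A}F$ is the infimum of $\alpha$ for which there is a constant $C>0$ such that $N_r(B(x,R)\cap F)\leq C(R/r)^\alpha$ for all $0<r<R$ and $x\in F$. *)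

theory Defs
  imports "HOL-Probability.Probability"
begin

text \<open>The covering sets are required to be bounded because \<^const>\<open>diameter\<close> is unspecified on unbounded sets.\<close>

definition covering_number :: "real \<Rightarrow> 'a::metric_space set \<Rightarrow> nat" where
  "covering_number r E =
     Inf {card C | C. finite C \<and> (\<forall>U\<in>C. bounded U \<and> diameter U = r) \<and> E \<subseteq> \<Union>C}"

definition upper_box_dim :: "'a::metric_space set \<Rightarrow> ereal" where
  "upper_box_dim E =
     Limsup (at_right 0) (\<lambda>r. ereal (ln (real (covering_number r E)) / - ln r))"

definition lower_box_dim :: "'a::metric_space set \<Rightarrow> ereal" where
  "lower_box_dim E =
     Liminf (at_right 0) (\<lambda>r. ereal (ln (real (covering_number r E)) / - ln r))"

definition packing_dim :: "'a::metric_space set \<Rightarrow> ereal" where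
  "packing_dim F =
     Inf {SUP j. upper_box_dim (K j) | K :: nat \<Rightarrow> 'a set.
            (\<forall>j. compact (K j) \<and> K j \<noteq> {}) \<and> F \<subseteq> (\<Union>j. K j)}"

definition assouad_dim :: "'a::metric_space set \<Rightarrow> ereal" where
  "assouad_dim F =
     Inf {ereal \<alpha> | \<alpha>. \<exists>C>0. \<forall>r R. \<forall>x\<in>F. 0 < r \<and> r < R \<longrightarrow>
            real (covering_number r (cball x R \<inter> F)) \<le> C * (R / r) powr \<alpha>}"

definition orth_proj :: "'a::euclidean_space set \<Rightarrow> 'a \<Rightarrow> 'a" where
  "orth_proj V x = (THE y. y \<in> V \<and> (\<forall>v\<in>V. orthogonal (x - y) v))"

definition grassmannian :: "nat \<Rightarrow> 'a::euclidean_space set set" where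
  "grassmannian m = {V. subspace V \<and> dim V = m}"

text \<open>
  The Borel sets of the Grassmannian for the usual topology, which is the one given by the metric
  \<open>\<parallel>\<pi>\<^sub>V - \<pi>\<^sub>W\<parallel>\<close>, that is, the topology induced by \<open>V \<mapsto> \<pi>\<^sub>V\<close> from the space of matrices.
\<close>

definition grassmann_borel :: "nat \<Rightarrow> (real^'n) set measure" where
  "grassmann_borel m = vimage_algebra (grassmannian m) (\<lambda>V. matrix (orth_proj V)) borel"

text \<open>
  The natural measure on the Grassmannian is the unique Borel probability measure that is invariant
  under the orthogonal group; existence is shown below.
\<close>

definition invariant_grassmann_measure :: "nat \<Rightarrow> (real^'n) set measure \<Rightarrow> bool" where
  "invariant_grassmann_measure m \<gamma> \<longleftrightarrow>
     prob_space \<gamma> \<and> sets \<gamma> = sets (grassmann_borel m) \<and>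
     (\<forall>g. orthogonal_transformation g \<longrightarrow> distr \<gamma> \<gamma> ((`) g) = \<gamma>)"

lemma nn_integral_lborel_translate:
  fixes t :: "'a::euclidean_space"
  assumes [measurable]: "h \<in> borel_measurable borel"
  shows "(\<integral>\<^sup>+x. h (t + x) \<partial>lborel) = (\<integral>\<^sup>+x. h x \<partial>lborel)"
proof -
  have "(\<integral>\<^sup>+x. h x \<partial>lborel) = (\<integral>\<^sup>+x. h x \<partial>distr lborel borel ((+) t))"
    by (simp add: lborel_distr_plus)
  also have "\<dots> = (\<integral>\<^sup>+x. h (t + x) \<partial>lborel)"
    by (subst nn_integral_distr) auto
  finally show ?thesis by simp
qed

lemma lborel_distr_orthogonal:
  fixes f :: "'a::euclidean_space \<Rightarrow> 'a"
  assumes f: "orthogonal_transformation f"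
  shows "distr lborel lborel f = lborel"
proof (rule measure_eqI)
  have bij: "bij f" using f by (rule orthogonal_transformation_bij)
  have lin: "linear f" using f by (simp add: orthogonal_transformation_linear)
  have [measurable]: "f \<in> borel_measurable borel"
    using lin by (intro borel_measurable_continuous_onI linear_continuous_on) (simp add: linear_conv_bounded_linear)
  let ?B = "ball 0 1 :: 'a set"
  let ?i = "\<lambda>A x. indicator A x :: ennreal"
  have [measurable]: "ball z 1 \<in> sets borel" for z :: 'a by simp
  have Bball: "emeasure lborel (ball z 1 :: 'a set) = emeasure lborel ?B" for z
  proof -
    have "emeasure lborel (ball z 1) = (\<integral>\<^sup>+x. ?i (ball z 1) x \<partial>lborel)" by simp
    also have "\<dots> = (\<integral>\<^sup>+x. ?i (ball z 1) (z + x) \<partial>lborel)"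
      by (rule nn_integral_lborel_translate[symmetric]) measurable
    also have "\<dots> = (\<integral>\<^sup>+x. ?i ?B x \<partial>lborel)"
      by (intro nn_integral_cong) (auto simp: indicator_def dist_norm)
    also have "\<dots> = emeasure lborel ?B" by simp
    finally show ?thesis .
  qed
  fix A assume "A \<in> sets (distr lborel lborel f)"
  then have [measurable]: "A \<in> sets borel" by simp
  have "emeasure (distr lborel lborel f) A = (\<integral>\<^sup>+x. ?i A x \<partial>distr lborel lborel f)" by simp
  also have "\<dots> = (\<integral>\<^sup>+x. ?i A (f x) \<partial>lborel)" by (subst nn_integral_distr) auto
  finally have "emeasure (distr lborel lborel f) A * emeasure lborel ?B =
      (\<integral>\<^sup>+x. ?i A (f x) \<partial>lborel) * (\<integral>\<^sup>+y. ?i ?B y \<partial>lborel)" by simp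
  also have "\<dots> = (\<integral>\<^sup>+y. (\<integral>\<^sup>+x. ?i A (f x) \<partial>lborel) * ?i ?B y \<partial>lborel)"
    by (rule nn_integral_cmult[symmetric]) measurable
  also have "\<dots> = (\<integral>\<^sup>+y. (\<integral>\<^sup>+x. ?i A (f x + y) * ?i ?B y \<partial>lborel) \<partial>lborel)"
  proof (rule nn_integral_cong)
    fix y
    have "f (inv f y + x) = f x + y" for x
      using bij by (simp add: linear_add[OF lin] bij_is_surj surj_f_inv_f)
    then have "(\<integral>\<^sup>+x. ?i A (f x) \<partial>lborel) = (\<integral>\<^sup>+x. ?i A (f x + y) \<partial>lborel)"
      using nn_integral_lborel_translate[of "\<lambda>x. ?i A (f x)" "inv f y"] by simp
    then show "(\<integral>\<^sup>+x. ?i A (f x) \<partial>lborel) * ?i ?B y = (\<integral>\<^sup>+x. ?i A (f x + y) * ?i ?B y \<partial>lborel)"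
      by (simp add: nn_integral_multc)
  qed
  also have "\<dots> = (\<integral>\<^sup>+x. (\<integral>\<^sup>+y. ?i A (f x + y) * ?i ?B y \<partial>lborel) \<partial>lborel)"
    by (rule lborel_pair.Fubini') measurable
  also have "\<dots> = (\<integral>\<^sup>+x. (\<integral>\<^sup>+y. ?i A y * ?i ?B (y - f x) \<partial>lborel) \<partial>lborel)"
  proof (rule nn_integral_cong)
    fix x
    show "(\<integral>\<^sup>+y. ?i A (f x + y) * ?i ?B y \<partial>lborel) = (\<integral>\<^sup>+y. ?i A y * ?i ?B (y - f x) \<partial>lborel)"
      using nn_integral_lborel_translate[of "\<lambda>y. ?i A y * ?i ?B (y - f x)" "f x"] by simp
  qed
  also have "\<dots> = (\<integral>\<^sup>+y. (\<integral>\<^sup>+x. ?i A y * ?i ?B (y - f x) \<partial>lborel) \<partial>lborel)"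
    by (rule lborel_pair.Fubini'[symmetric]) measurable
  also have "\<dots> = (\<integral>\<^sup>+y. ?i A y * emeasure lborel ?B \<partial>lborel)"
  proof (rule nn_integral_cong)
    fix y
    have "ball (inv f y) 1 \<in> sets lborel" by simp
    have "norm (y - f x) = dist (inv f y) x" for x
      using bij orthogonal_transformation_norm[OF f, of "inv f y - x"]
      by (simp add: linear_diff[OF lin] bij_is_surj surj_f_inv_f dist_norm)
    then have "?i ?B (y - f x) = ?i (ball (inv f y) 1) x" for x
      by (simp add: indicator_def)
    then have "(\<integral>\<^sup>+x. ?i A y * ?i ?B (y - f x) \<partial>lborel)
        = (\<integral>\<^sup>+x. ?i A y * ?i (ball (inv f y) 1) x \<partial>lborel)"
      by (intro nn_integral_cong) (rule arg_cong)
    also have "\<dots> = ?i A y * (\<integral>\<^sup>+x. ?i (ball (inv f y) 1) x \<partial>lborel)"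
      by (rule nn_integral_cmult) measurable
    finally show "(\<integral>\<^sup>+x. ?i A y * ?i ?B (y - f x) \<partial>lborel) = ?i A y * emeasure lborel ?B"
      by (simp only: Bball[of "inv f y"] nn_integral_indicator[OF \<open>ball (inv f y) 1 \<in> sets lborel\<close>])
  qed
  also have "\<dots> = emeasure lborel A * emeasure lborel ?B" by (simp add: nn_integral_multc)
  finally have eq: "emeasure (distr lborel lborel f) A * emeasure lborel ?B
      = emeasure lborel A * emeasure lborel ?B" .
  have "emeasure lborel ?B \<noteq> 0" "emeasure lborel ?B \<noteq> \<infinity>"
    using content_ball_pos[of 1 "0 :: 'a"] emeasure_bounded_finite[of ?B] by (auto simp: measure_def)
  then show "emeasure (distr lborel lborel f) A = emeasure lborel A"
    using eq by (simp add: mult.commute[of _ "emeasure lborel ?B"] ennreal_mult_cancel_left)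
qed simp

lemma orth_proj_props:
  fixes V :: "'a::euclidean_space set"
  assumes "subspace V"
  shows "orth_proj V x \<in> V" "\<And>v. v \<in> V \<Longrightarrow> orthogonal (x - orth_proj V x) v"
proof -
  obtain y z where y: "y \<in> span V" "\<And>w. w \<in> span V \<Longrightarrow> orthogonal z w" "x = y + z"
    using orthogonal_subspace_decomp_exists by blast
  have sp: "span V = V" using assms by (simp add: span_eq_iff)
  have "\<exists>!y. y \<in> V \<and> (\<forall>v\<in>V. orthogonal (x - y) v)"
  proof
    show "y \<in> V \<and> (\<forall>v\<in>V. orthogonal (x - y) v)" using y sp by auto
  next
    fix w assume w: "w \<in> V \<and> (\<forall>v\<in>V. orthogonal (x - w) v)"
    have "w - y \<in> V" using w y sp assms by (auto intro: subspace_diff)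
    then have "orthogonal (x - w) (w - y)" "orthogonal (x - y) (w - y)"
      using w y sp by auto
    then have "(w - y) \<bullet> (w - y) = 0" by (simp add: orthogonal_def inner_diff_left)
    then show "w = y" by simp
  qed
  from theI'[OF this] show "orth_proj V x \<in> V" "\<And>v. v \<in> V \<Longrightarrow> orthogonal (x - orth_proj V x) v"
    unfolding orth_proj_def by auto
qed

lemma orth_proj_unique:
  fixes V :: "'a::euclidean_space set"
  assumes "subspace V" "y \<in> V" "\<And>v. v \<in> V \<Longrightarrow> orthogonal (x - y) v"
  shows "orth_proj V x = y"
proof -
  let ?w = "orth_proj V x"
  have "?w - y \<in> V" using orth_proj_props[OF assms(1)] assms by (auto intro: subspace_diff)
  then have "orthogonal (x - ?w) (?w - y)" "orthogonal (x - y) (?w - y)"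
    using orth_proj_props[OF assms(1)] assms by auto
  then have "(?w - y) \<bullet> (?w - y) = 0" by (simp add: orthogonal_def inner_diff_left)
  then show ?thesis by simp
qed

lemma linear_orth_proj:
  fixes V :: "'a::euclidean_space set"
  assumes V: "subspace V"
  shows "linear (orth_proj V)"
proof (rule linearI)
  note p = orth_proj_props[OF V]
  show "orth_proj V (a + b) = orth_proj V a + orth_proj V b" for a b
  proof (rule orth_proj_unique[OF V])
    show "orth_proj V a + orth_proj V b \<in> V" using p V by (auto intro: subspace_add)
    show "orthogonal (a + b - (orth_proj V a + orth_proj V b)) v" if "v \<in> V" for v
      using p(2)[OF that, of a] p(2)[OF that, of b] by (simp add: orthogonal_def algebra_simps)
  qed
  show "orth_proj V (c *\<^sub>R b) = c *\<^sub>R orth_proj V b" for c b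
  proof (rule orth_proj_unique[OF V])
    show "c *\<^sub>R orth_proj V b \<in> V" using p V by (auto intro: subspace_scale)
    show "orthogonal (c *\<^sub>R b - c *\<^sub>R orth_proj V b) v" if "v \<in> V" for v
      using p(2)[OF that, of b] by (simp add: orthogonal_def algebra_simps)
  qed
qed

lemma infdist_orth_proj:
  fixes V :: "'a::euclidean_space set"
  assumes V: "subspace V"
  shows "(infdist x V)\<^sup>2 = (norm x)\<^sup>2 - orth_proj V x \<bullet> x"
proof -
  note p = orth_proj_props[OF V]
  let ?y = "orth_proj V x"
  have "infdist x V = dist x ?y"
  proof (rule antisym)
    show "infdist x V \<le> dist x ?y" using p by (simp add: infdist_le)
    have "V \<noteq> {}" using p by auto
    moreover have "dist x ?y \<le> dist x v" if "v \<in> V" for v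
    proof -
      have "orthogonal (x - ?y) (?y - v)" using p that V by (auto intro: subspace_diff)
      then have "(norm (x - ?y + (?y - v)))\<^sup>2 = (norm (x - ?y))\<^sup>2 + (norm (?y - v))\<^sup>2"
        by (rule norm_add_Pythagorean)
      then have "(norm (x - ?y))\<^sup>2 \<le> (norm (x - v))\<^sup>2" by simp
      then show ?thesis by (simp add: dist_norm)
    qed
    ultimately show "dist x ?y \<le> infdist x V" by (simp add: infdist_def cINF_greatest)
  qed
  moreover have "(x - ?y) \<bullet> ?y = 0" using p by (simp add: orthogonal_def)
  ultimately show ?thesis
    by (simp add: dist_norm power2_norm_eq_inner inner_diff_left inner_diff_right inner_commute)
qed

lemma orth_proj_polar:
  fixes V :: "'a::euclidean_space set"
  assumes V: "subspace V"
  shows "orth_proj V x \<bullet> y =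
    ((norm (x+y))\<^sup>2 - (infdist (x+y) V)\<^sup>2 - (norm x)\<^sup>2 + (infdist x V)\<^sup>2
      - (norm y)\<^sup>2 + (infdist y V)\<^sup>2) / 2"
proof -
  note p = orth_proj_props[OF V]
  have "(x - orth_proj V x) \<bullet> orth_proj V y = 0" "(y - orth_proj V y) \<bullet> orth_proj V x = 0"
    using p by (auto simp: orthogonal_def)
  then have "orth_proj V x \<bullet> y = orth_proj V y \<bullet> x"
    by (simp add: inner_diff_left inner_commute[of y] inner_commute[of x] inner_commute[of "orth_proj V x" "orth_proj V y"])
  then show ?thesis
    by (simp add: infdist_orth_proj[OF V] linear_add[OF linear_orth_proj[OF V]] inner_add_left inner_add_right)
qed

lemma infdist_closure_eq: "infdist x (closure A) = infdist x A" if "A \<noteq> {}"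
proof (rule antisym)
  show "infdist x (closure A) \<le> infdist x A"
    using that by (intro infdist_mono closure_subset)
  have "infdist x A \<le> dist x y" if "y \<in> closure A" for y
    using infdist_triangle[of x A y] that \<open>A \<noteq> {}\<close> by (simp add: in_closure_iff_infdist_zero)
  then show "infdist x A \<le> infdist x (closure A)"
    using that by (auto simp: infdist_def[of x "closure A"] intro!: cINF_greatest)
qed

lemma infdist_linear_image:
  fixes f :: "'a::euclidean_space \<Rightarrow> 'b::euclidean_space"
  assumes "linear f" "V \<noteq> {}" "D \<subseteq> V" "V \<subseteq> closure D"
  shows "infdist x (f ` V) = (INF d\<in>D. dist x (f d))"
proof -
  have "D \<noteq> {}" using assms(2,4) by auto
  have c: "f ` closure D \<subseteq> closure (f ` D)"
    using assms(1) by (intro closure_linear_image_subset)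
  have "closure (f ` D) = closure (f ` V)"
  proof
    show "closure (f ` D) \<subseteq> closure (f ` V)" using assms by (intro closure_mono) auto
    have "f ` V \<subseteq> closure (f ` D)" using c assms by blast
    then show "closure (f ` V) \<subseteq> closure (f ` D)" by (simp add: closure_minimal)
  qed
  then have "infdist x (f ` V) = infdist x (f ` D)"
    using infdist_closure_eq[of "f ` V" x] infdist_closure_eq[of "f ` D" x] \<open>D \<noteq> {}\<close> assms(2) by simp
  then show ?thesis using \<open>D \<noteq> {}\<close> by (simp add: infdist_def image_image)
qed


lemma subspace_dim_matrix_image:
  fixes M :: "real^'n^'n"
  assumes "det M \<noteq> 0" "subspace V"
  shows "subspace ((*v) M ` V)" "dim ((*v) M ` V) = dim V"
proof -
  show "subspace ((*v) M ` V)"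
    using assms by (intro linear_subspace_image) auto
  have "inj ((*v) M)"
    using assms(1) by (metis inj_matrix_vector_mult invertible_det_nz)
  then show "dim ((*v) M ` V) = dim V"
    by (intro dim_image_eq) (auto intro: inj_on_subset)
qed

lemma orth_proj_orthogonal_image:
  fixes g :: "'a::euclidean_space \<Rightarrow> 'a"
  assumes g: "orthogonal_transformation g" and V: "subspace V"
  shows "orth_proj (g ` V) (g x) = g (orth_proj V x)"
proof (rule orth_proj_unique)
  have lin: "linear g" using g by (simp add: orthogonal_transformation_linear)
  show "subspace (g ` V)" using lin V by (rule linear_subspace_image)
  show "g (orth_proj V x) \<in> g ` V" using orth_proj_props[OF V] by auto
  fix v assume "v \<in> g ` V"
  then obtain w where w: "w \<in> V" "v = g w" by auto
  have "(g (x - orth_proj V x)) \<bullet> g w = (x - orth_proj V x) \<bullet> w"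
    using g by (simp add: orthogonal_transformation_def)
  then show "orthogonal (g x - g (orth_proj V x)) v"
    using orth_proj_props(2)[OF V w(1), of x] w lin by (simp add: orthogonal_def linear_diff)
qed

lemma measurable_orthogonal_image_grassmann:
  fixes g :: "real^'n \<Rightarrow> real^'n"
  assumes g: "orthogonal_transformation g"
  shows "(`) g \<in> measurable (grassmann_borel m) (grassmann_borel m)"
  unfolding grassmann_borel_def
proof (rule measurable_vimage_algebra2)
  let ?G = "vimage_algebra (grassmannian m) (\<lambda>V. matrix (orth_proj V)) (borel :: (real^'n^'n) measure)"
  have lin: "linear g" and inj: "inj g"
    using g by (auto simp: orthogonal_transformation_linear orthogonal_transformation_inj)
  show "(`) g \<in> space ?G \<rightarrow> grassmannian m"
    using lin inj by (auto simp: grassmannian_def intro!: linear_subspace_image dim_image_eq inj_on_subset[OF inj])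
  let ?c = "\<lambda>M. matrix g ** M ** matrix (inv g)"
  have "(\<lambda>V. matrix (orth_proj V)) \<in> measurable ?G borel"
    by (rule measurable_vimage_algebra1) auto
  moreover have "?c \<in> borel_measurable borel"
    by (intro borel_measurable_continuous_onI) (auto simp: matrix_matrix_mult_def intro!: continuous_intros)
  ultimately have m: "(\<lambda>V. ?c (matrix (orth_proj V))) \<in> measurable ?G borel"
    by (rule measurable_compose)
  have "matrix (orth_proj (g ` V)) = ?c (matrix (orth_proj V))" if V: "subspace V" for V
  proof -
    have linv: "linear (inv g)"
      using g orthogonal_transformation_inv orthogonal_transformation_linear by blast
    have lp: "linear (orth_proj V)" using V by (rule linear_orth_proj)
    have "orth_proj (g ` V) = (g \<circ> orth_proj V) \<circ> inv g"
    proof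
      fix x
      have "g (inv g x) = x" using orthogonal_transformation_bij[OF g] by (simp add: bij_is_surj surj_f_inv_f)
      then show "orth_proj (g ` V) x = ((g \<circ> orth_proj V) \<circ> inv g) x"
        using orth_proj_orthogonal_image[OF g V, of "inv g x"] by simp
    qed
    moreover have "linear (g \<circ> orth_proj V)" using lp lin by (rule linear_compose)
    ultimately show ?thesis
      using lin lp linv by (simp add: matrix_compose)
  qed
  then show "(\<lambda>V. matrix (orth_proj (g ` V))) \<in> measurable ?G borel"
    using m by (subst measurable_cong) (auto simp: grassmannian_def)
qed

theorem exists_invariant_grassmann_measure:
  assumes m: "m \<le> CARD('n)"
  shows "\<exists>\<gamma> :: (real^'n) set measure. invariant_grassmann_measure m \<gamma>"
proof -
  obtain V0 :: "(real^'n) set" where V0: "subspace V0" "dim V0 = m"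
    using choose_subspace_of_subspace[of m "UNIV :: (real^'n) set"] m by auto
  obtain D where D: "countable D" "D \<subseteq> V0" "V0 \<subseteq> closure D"
    using separable by blast
  have V0ne: "V0 \<noteq> {}" using subspace_0[OF V0(1)] by auto
  then have Dne: "D \<noteq> {}" using D(3) by auto

  define S :: "(real^'n^'n) set" where "S = {A. det A \<noteq> 0} \<inter> ball 0 (norm (mat 1 :: real^'n^'n) + 1)"
  have "continuous_on UNIV (\<lambda>A :: real^'n^'n. det A)"
    unfolding det_def by (intro continuous_intros)
  then have "open ((\<lambda>A :: real^'n^'n. det A) -` (- {0}))"
    by (intro open_vimage) auto
  then have oS: "open S" unfolding S_def by (auto simp: vimage_def)
  have bS: "bounded S" unfolding S_def by (intro bounded_Int) auto
  have "mat 1 \<in> S" by (simp add: S_def)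
  then have "S \<noteq> {}" by auto
  then obtain z e where e: "e > 0" "ball z e \<subseteq> S" using oS open_contains_ball by blast
  have Sm[measurable]: "S \<in> sets borel" using oS by auto
  have S0: "emeasure lborel S \<noteq> 0"
  proof -
    have "0 < measure lborel (ball z e)" using e by (simp add: content_ball_pos)
    then have "0 < emeasure lborel (ball z e)" by (auto simp: measure_def zero_less_iff_neq_zero)
    also have "\<dots> \<le> emeasure lborel S" using e by (intro emeasure_mono) auto
    finally show ?thesis by simp
  qed
  have Sfin: "emeasure lborel S \<noteq> \<infinity>"
    using emeasure_bounded_finite[OF bS] by simp
  define P where "P = uniform_measure lborel S"
  interpret P: prob_space P
    unfolding P_def using S0 Sfin by (rule prob_space_uniform_measure)
  have spP[simp]: "space P = UNIV" and seP[measurable_cong]: "sets P = sets borel" by (auto simp: P_def)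
  have AES: "AE A in P. A \<in> S"
    unfolding P_def by (rule AE_uniform_measureI) auto

  define T where "T A = (if A \<in> S then (*v) A ` V0 else V0)" for A
  have T_in: "T A \<in> grassmannian m" for A
    using V0 subspace_dim_matrix_image[OF _ V0(1), of "A"] by (auto simp: T_def grassmannian_def S_def)
  have infT: "(\<lambda>A. infdist x (T A)) \<in> borel_measurable P" for x
  proof -
    have "infdist x (T A) = (if A \<in> S then (INF d\<in>D. dist x (A *v d)) else infdist x V0)" for A
      using infdist_linear_image[OF _ V0ne D(2,3), of "(*v) A"] by (auto simp: T_def)
    moreover have "(\<lambda>A :: real^'n^'n. INF d\<in>D. dist x (A *v d)) \<in> borel_measurable borel"
    proof (rule borel_measurable_cINF_real)
      fix d :: "real^'n"
      have "continuous_on UNIV (\<lambda>A :: real^'n^'n. dist x (A *v d))"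
        unfolding matrix_vector_mult_def by (intro continuous_intros)
      then show "(\<lambda>A :: real^'n^'n. dist x (A *v d)) \<in> borel_measurable borel"
        by (rule borel_measurable_continuous_onI)
    qed (rule D)
    ultimately show ?thesis by (simp add: measurable_If_set)
  qed
  have T_meas: "T \<in> measurable P (grassmann_borel m)"
    unfolding grassmann_borel_def
  proof (rule measurable_vimage_algebra2)
    show "T \<in> space P \<rightarrow> grassmannian m" using T_in by auto
    have sub: "subspace (T A)" for A using T_in[of A] by (auto simp: grassmannian_def)
    show "(\<lambda>A. matrix (orth_proj (T A))) \<in> borel_measurable P"
    proof (subst borel_measurable_euclidean_space, intro ballI)
      fix b :: "real^'n^'n" assume "b \<in> Basis"
      then obtain i j where b: "b = axis i (axis j 1)" by (auto simp: Basis_vec_def)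
      have "matrix (orth_proj (T A)) \<bullet> b = orth_proj (T A) (axis j 1) \<bullet> axis i 1" for A
        by (simp add: b inner_axis matrix_def)
      also have "\<dots> A = ((norm (axis j 1+axis i 1 :: real^'n))\<^sup>2 - (infdist (axis j 1+axis i 1) (T A))\<^sup>2
        - (norm (axis j 1 :: real^'n))\<^sup>2 + (infdist (axis j 1) (T A))\<^sup>2
        - (norm (axis i 1 :: real^'n))\<^sup>2 + (infdist (axis i 1) (T A))\<^sup>2) / 2" for A
        by (rule orth_proj_polar[OF sub])
      finally have eq: "matrix (orth_proj (T A)) \<bullet> b = \<dots> A" for A .
      show "(\<lambda>A. matrix (orth_proj (T A)) \<bullet> b) \<in> borel_measurable P"
        unfolding eq by (intro borel_measurable_divide borel_measurable_add borel_measurable_diff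
            borel_measurable_power borel_measurable_const infT)
    qed
  qed

  define \<gamma> where "\<gamma> = distr P (grassmann_borel m) T"
  have se\<gamma>: "sets \<gamma> = sets (grassmann_borel m)" by (simp add: \<gamma>_def)
  have "distr \<gamma> \<gamma> ((`) g) = \<gamma>" if g: "orthogonal_transformation g" for g :: "real^'n \<Rightarrow> real^'n"
  proof -
    have lin: "linear g" using g by (simp add: orthogonal_transformation_linear)
    define G where "G = matrix g"
    have gG: "g x = G *v x" for x using lin by (simp add: G_def matrix_works)
    define \<Phi> :: "real^'n^'n \<Rightarrow> real^'n^'n" where "\<Phi> A = G ** A" for A
    have norm_col: "(norm A)\<^sup>2 = (\<Sum>j\<in>UNIV. (norm (column j A))\<^sup>2)" for A :: "real^'n^'n"
    proof -
      have "(norm A)\<^sup>2 = (\<Sum>i\<in>UNIV. \<Sum>j\<in>UNIV. (A $ i $ j)\<^sup>2)"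
        by (simp add: norm_vec_def L2_set_def sum_nonneg)
      also have "\<dots> = (\<Sum>j\<in>UNIV. \<Sum>i\<in>UNIV. (A $ i $ j)\<^sup>2)" by (rule sum.swap)
      also have "\<dots> = (\<Sum>j\<in>UNIV. (norm (column j A))\<^sup>2)"
        by (simp add: norm_vec_def L2_set_def sum_nonneg column_def)
      finally show ?thesis .
    qed
    have col: "column j (G ** M) = g (column j M)" for j and M :: "real^'n^'n"
      by (simp add: gG column_def matrix_matrix_mult_def matrix_vector_mult_def)
    have norm\<Phi>: "norm (\<Phi> A) = norm A" for A
    proof -
      have "(norm (\<Phi> A))\<^sup>2 = (norm A)\<^sup>2"
        by (simp add: norm_col \<Phi>_def col orthogonal_transformation_norm[OF g])
      then show ?thesis by simp
    qed
    have "linear \<Phi>"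
      by (rule linearI)
        (simp_all add: \<Phi>_def matrix_matrix_mult_def vec_eq_iff algebra_simps sum.distrib sum_distrib_left)
    then have ot: "orthogonal_transformation \<Phi>"
      using norm\<Phi> by (simp add: orthogonal_transformation)
    have "\<Phi> \<in> borel_measurable borel"
      using \<open>linear \<Phi>\<close> by (intro borel_measurable_continuous_onI linear_continuous_on)
        (simp add: linear_conv_bounded_linear)
    then have \<Phi>m[measurable]: "\<Phi> \<in> measurable borel borel" .
    have "det G \<noteq> 0"
      using g det_orthogonal_matrix[of "matrix g"] by (auto simp: G_def orthogonal_transformation_matrix)
    then have \<Phi>S: "\<Phi> A \<in> S \<longleftrightarrow> A \<in> S" for A
      using norm\<Phi>[of A] by (simp add: S_def \<Phi>_def det_mul)
    have distP: "distr P P \<Phi> = P"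
    proof (rule measure_eqI)
      fix A assume "A \<in> sets (distr P P \<Phi>)"
      then have A[measurable]: "A \<in> sets borel" by (simp add: seP)
      have pre: "\<Phi> -` A \<in> sets borel" using measurable_sets_borel[OF \<Phi>m A] .
      have "emeasure (distr P P \<Phi>) A = emeasure P (\<Phi> -` A)"
        by (subst emeasure_distr) (auto simp: seP cong: measurable_cong_sets)
      also have "\<dots> = emeasure lborel (S \<inter> \<Phi> -` A) / emeasure lborel S"
        using pre by (simp add: P_def emeasure_uniform_measure)
      also have "S \<inter> \<Phi> -` A = \<Phi> -` (S \<inter> A)" using \<Phi>S by auto
      also have "emeasure lborel (\<Phi> -` (S \<inter> A)) = emeasure (distr lborel lborel \<Phi>) (S \<inter> A)"
        by (subst emeasure_distr) auto
      also have "\<dots> = emeasure lborel (S \<inter> A)" by (simp add: lborel_distr_orthogonal[OF ot])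
      also have "\<dots> / emeasure lborel S = emeasure P A"
        by (simp add: P_def emeasure_uniform_measure)
      finally show "emeasure (distr P P \<Phi>) A = emeasure P A" .
    qed simp
    have gm: "(`) g \<in> measurable (grassmann_borel m) (grassmann_borel m)"
      using g by (rule measurable_orthogonal_image_grassmann)
    have \<Phi>P: "\<Phi> \<in> measurable P P" using \<Phi>m by (simp add: seP cong: measurable_cong_sets)
    have "distr \<gamma> \<gamma> ((`) g) = distr \<gamma> (grassmann_borel m) ((`) g)"
      by (rule distr_cong) (auto simp: se\<gamma>)
    also have "\<dots> = distr P (grassmann_borel m) ((`) g \<circ> T)"
      unfolding \<gamma>_def using gm T_meas by (rule distr_distr)
    also have "\<dots> = distr P (grassmann_borel m) (T \<circ> \<Phi>)"
    proof (rule distr_cong_AE)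
      show "AE A in P. ((`) g \<circ> T) A = (T \<circ> \<Phi>) A"
        using AES
      proof eventually_elim
        case (elim A)
        then show ?case
          using \<Phi>S[of A] by (simp add: T_def \<Phi>_def image_image gG matrix_vector_mul_assoc)
      qed
      show "(`) g \<circ> T \<in> measurable P (grassmann_borel m)" using T_meas gm by (rule measurable_comp)
      show "T \<circ> \<Phi> \<in> measurable P (grassmann_borel m)" using \<Phi>P T_meas by (rule measurable_comp)
    qed simp_all
    also have "\<dots> = distr (distr P P \<Phi>) (grassmann_borel m) T"
      using T_meas \<Phi>P by (rule distr_distr[symmetric])
    also have "\<dots> = \<gamma>" by (simp add: distP \<gamma>_def)
    finally show ?thesis .
  qed
  moreover have "prob_space \<gamma>" unfolding \<gamma>_def using T_meas by (rule P.prob_space_distr)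
  ultimately show ?thesis
    using se\<gamma> unfolding invariant_grassmann_measure_def by blast
qed

end

theory Submission
  imports Defs "HOL-Real_Asymp.Real_Asymp"
begin

text \<open>
  Let \<open>a\<close> be the Assouad dimension. For almost all \<open>V\<close> the projection of a bounded set \<open>E \<subseteq> F\<close> has box
  dimensions at least \<open>m / a\<close> times those of \<open>E\<close>, which is stronger than the claim since
  \<open>m / a \<ge> 2 - a / m\<close>. Take a maximal \<open>r/2\<close>-separated set of \<open>N\<close> points in \<open>E\<close>. The probability that two
  points at distance \<open>\<delta>\<close> have projections within \<open>r\<close> is \<open>O((r/\<delta>)\<^sup>m)\<close>. For \<open>\<alpha> > a\<close>, the \<open>k\<close>-th nearest
  neighbour of a point is at distance at least of order \<open>k\<^bsup>1/\<alpha>\<^esup> r\<close>, so the expected number of pairs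
  with close projections is \<open>O(N\<^bsup>2 - m/\<alpha>\<^esup>)\<close>. By Borel-Cantelli along \<open>r = 2\<^bsup>-k\<^esup>\<close> and Cauchy-Schwarz,
  the projection needs about \<open>N\<^bsup>m/\<alpha>\<^esup>\<close> sets to be covered.

  For the packing dimension, the Borel set \<open>F\<close> is the projection of a closed subset of a Polish space,
  and a Baire category argument on that subset reduces the bound to countably many bounded pieces of
  \<open>F\<close> of large upper box dimension.
\<close>

subsection \<open>Covering numbers\<close>

text \<open>Compactness of the closure gives finitely many balls of radius \<open>r/2\<close>, and
  closed balls of that radius have diameter exactly \<open>r\<close>. So the infimum in
  \<open>covering_number\<close> runs over a nonempty set of naturals and is attained.\<close>

lemma exists_finite_cover_diameter:
  fixes E :: "'a::euclidean_space set"
  assumes "bounded E" "0 < r"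
  shows "\<exists>C. finite C \<and> (\<forall>U\<in>C. bounded U \<and> diameter U = r) \<and> E \<subseteq> \<Union>C"
proof -
  have "compact (closure E)" using assms(1) by (simp add: compact_closure)
  then obtain T where T: "finite T" "closure E \<subseteq> (\<Union>x\<in>T. ball x (r/2))"
  proof (rule compactE_image[of "closure E" "closure E" "\<lambda>x. ball x (r/2)"])
    show "closure E \<subseteq> (\<Union>x\<in>closure E. ball x (r/2))" using assms(2) by auto
  qed auto
  let ?C = "(\<lambda>x. cball x (r/2)) ` T"
  have "E \<subseteq> \<Union>?C"
  proof
    fix v assume "v \<in> E"
    then obtain x where "x \<in> T" "v \<in> ball x (r/2)" using T(2) closure_subset[of E] by auto
    then show "v \<in> \<Union>?C" by (intro UN_I[of x]) auto
  qed
  then show ?thesis using T(1) assms(2) by (intro exI[of _ ?C]) auto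
qed

lemma covering_number_le_card:
  assumes "finite C" "\<And>U. U \<in> C \<Longrightarrow> bounded U \<and> diameter U = r" "E \<subseteq> \<Union>C"
  shows "covering_number r E \<le> card C"
proof -
  have "card C \<in> {card C | C. finite C \<and> (\<forall>U\<in>C. bounded U \<and> diameter U = r) \<and> E \<subseteq> \<Union>C}"
    using assms by (intro CollectI exI[of _ C]) auto
  then show ?thesis unfolding covering_number_def by (rule wellorder_Inf_le1)
qed

lemma covering_number_attained:
  fixes E :: "'a::euclidean_space set"
  assumes "bounded E" "0 < r"
  obtains C where "finite C" "\<And>U. U \<in> C \<Longrightarrow> bounded U \<and> diameter U = r" "E \<subseteq> \<Union>C"
    "card C = covering_number r E"
proof -
  obtain C0 where "finite C0 \<and> (\<forall>U\<in>C0. bounded U \<and> diameter U = r) \<and> E \<subseteq> \<Union>C0"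
    using exists_finite_cover_diameter[OF assms] by blast
  then have "card C0 \<in>
      {card C | C. finite C \<and> (\<forall>U\<in>C. bounded U \<and> diameter U = r) \<and> E \<subseteq> \<Union>C}"
    by (intro CollectI exI[of _ C0]) auto
  then have "covering_number r E \<in>
      {card C | C. finite C \<and> (\<forall>U\<in>C. bounded U \<and> diameter U = r) \<and> E \<subseteq> \<Union>C}"
    unfolding covering_number_def by (rule wellorder_InfI)
  then obtain C where "covering_number r E = card C" "finite C"
      "\<forall>U\<in>C. bounded U \<and> diameter U = r" "E \<subseteq> \<Union>C"
    by blast
  then show ?thesis using that[of C] by simp
qed

lemma covering_number_mono:
  fixes E :: "'a::euclidean_space set"
  assumes "E \<subseteq> E'" "bounded E'" "0 < r"
  shows "covering_number r E \<le> covering_number r E'"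
proof -
  obtain C where "finite C" "\<And>U. U \<in> C \<Longrightarrow> bounded U \<and> diameter U = r" "E' \<subseteq> \<Union>C"
    "card C = covering_number r E'" using covering_number_attained[OF assms(2,3)] by blast
  then show ?thesis using covering_number_le_card[of C r E] assms(1) by force
qed

lemma covering_number_pos:
  fixes E :: "'a::euclidean_space set"
  assumes "bounded E" "0 < r" "E \<noteq> {}"
  shows "1 \<le> covering_number r E"
proof -
  obtain C where "finite C" "E \<subseteq> \<Union>C" "card C = covering_number r E"
    using covering_number_attained[OF assms(1,2)] by metis
  moreover have "C \<noteq> {}" using \<open>E \<subseteq> \<Union>C\<close> assms(3) by auto
  ultimately show ?thesis using card_gt_0_iff[of C] by linarith
qed

text \<open>Covering sets must have diameter exactly \<open>\<rho>\<close>, so each set of diameter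
  \<open>r\<close> is replaced by the closed ball of radius \<open>\<rho>/2\<close> about one of its
  points. The ball contains the set because \<open>r \<le> \<rho>/2\<close>.\<close>

lemma covering_number_antimono_radius:
  fixes E :: "'a::euclidean_space set"
  assumes "bounded E" "0 < r" "2 * r \<le> \<rho>"
  shows "covering_number \<rho> E \<le> covering_number r E"
proof -
  obtain C where C: "finite C" "\<And>U. U \<in> C \<Longrightarrow> bounded U \<and> diameter U = r" "E \<subseteq> \<Union>C"
    "card C = covering_number r E" using covering_number_attained[OF assms(1,2)] by blast
  let ?c = "\<lambda>U. cball (SOME u. u \<in> U) (\<rho>/2)"
  have sub: "U \<subseteq> ?c U" if "U \<in> C" for U
  proof
    fix v assume v: "v \<in> U"
    then have "(SOME u. u \<in> U) \<in> U" by (rule someI)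
    then have "dist (SOME u. u \<in> U) v \<le> r" using diameter_bounded_bound[of U] C(2)[OF that] v by auto
    then show "v \<in> ?c U" using assms by simp
  qed
  have "E \<subseteq> \<Union>(?c ` C)"
  proof
    fix v assume "v \<in> E"
    then obtain U where "U \<in> C" "v \<in> U" using C(3) by auto
    then show "v \<in> \<Union>(?c ` C)" using sub by blast
  qed
  then have "covering_number \<rho> E \<le> card (?c ` C)"
    using C(1) assms by (intro covering_number_le_card) auto
  also have "\<dots> \<le> covering_number r E" using card_image_le[OF C(1)] C(4) by simp
  finally show ?thesis .
qed

text \<open>A finite union of closures is closed, and taking closures does not change
  diameters.\<close>

lemma covering_number_closure_le:
  fixes E :: "'a::euclidean_space set"
  assumes "bounded E" "0 < r"
  shows "covering_number r (closure E) \<le> covering_number r E"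
proof -
  obtain C where C: "finite C" "\<And>U. U \<in> C \<Longrightarrow> bounded U \<and> diameter U = r" "E \<subseteq> \<Union>C"
    "card C = covering_number r E" using covering_number_attained[OF assms] by blast
  have "closed (\<Union>(closure ` C))" using C(1) by auto
  moreover have "E \<subseteq> \<Union>(closure ` C)"
  proof
    fix v assume "v \<in> E"
    then obtain U where "U \<in> C" "v \<in> U" using C(3) by auto
    then show "v \<in> \<Union>(closure ` C)" using closure_subset[of U] by (intro UN_I[of U]) auto
  qed
  ultimately have "closure E \<subseteq> \<Union>(closure ` C)" by (rule closure_minimal[rotated])
  then have "covering_number r (closure E) \<le> card (closure ` C)"
    using C(1,2) by (intro covering_number_le_card) (auto simp: diameter_closure)
  also have "\<dots> \<le> covering_number r E" using card_image_le[OF C(1)] C(4) by simp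
  finally show ?thesis .
qed

section \<open>Separated sets and pairs of close points\<close>

text \<open>Two points more than \<open>r\<close> apart cannot share a set of diameter
  \<open>r\<close>, so choosing a covering set for each point is injective.\<close>

lemma card_separated_le_covering_number:
  fixes E :: "'a::euclidean_space set"
  assumes "bounded E" "0 < r" "X \<subseteq> E"
    and sep: "\<And>x y. x \<in> X \<Longrightarrow> y \<in> X \<Longrightarrow> x \<noteq> y \<Longrightarrow> r < dist x y"
  shows "finite X" "card X \<le> covering_number r E"
proof -
  obtain C where C: "finite C" "\<And>U. U \<in> C \<Longrightarrow> bounded U \<and> diameter U = r" "E \<subseteq> \<Union>C"
    "card C = covering_number r E" using covering_number_attained[OF assms(1,2)] by blast
  have "\<forall>x\<in>X. \<exists>U\<in>C. x \<in> U" using C(3) assms(3) by auto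
  then obtain c where c: "\<And>x. x \<in> X \<Longrightarrow> c x \<in> C \<and> x \<in> c x" by metis
  have inj: "inj_on c X"
  proof (rule inj_onI, rule ccontr)
    fix x y assume *: "x \<in> X" "y \<in> X" "c x = c y" "x \<noteq> y"
    then have "dist x y \<le> diameter (c x)" using c C(2) diameter_bounded_bound by metis
    then show False using sep[OF *(1,2,4)] C(2) c *(1) by fastforce
  qed
  have sub: "c ` X \<subseteq> C" using c by auto
  then show "finite X" using inj C(1) finite_imageD finite_subset by metis
  show "card X \<le> covering_number r E" using card_inj_on_le[OF inj sub C(1)] C(4) by simp
qed

text \<open>A separated set of largest cardinality exists because the cardinalities are bounded by
  the covering number at radius \<open>r/2\<close>. By maximality the closed balls of radius
  \<open>r/2\<close> about its points, which have diameter \<open>r\<close>, cover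
  \<open>E\<close>.\<close>

lemma exists_separated_set:
  fixes E :: "'a::euclidean_space set"
  assumes "bounded E" "0 < r"
  obtains X where "X \<subseteq> E" "finite X" "covering_number r E \<le> card X"
    "\<And>x y. x \<in> X \<Longrightarrow> y \<in> X \<Longrightarrow> x \<noteq> y \<Longrightarrow> r / 2 < dist x y"
proof -
  define P where "P X \<longleftrightarrow> X \<subseteq> E \<and> (\<forall>x\<in>X. \<forall>y\<in>X. x \<noteq> y \<longrightarrow> r / 2 < dist x y)" for X
  have fin: "finite X" "card X \<le> covering_number (r/2) E" if "P X" for X
    using card_separated_le_covering_number[of E "r/2" X] assms that by (auto simp: P_def)
  have "P {}" by (simp add: P_def)
  then obtain X where X: "P X" "\<And>Y. P Y \<Longrightarrow> card Y \<le> card X"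
    using ex_has_greatest_nat[of P "{}" card "Suc (covering_number (r/2) E)"] fin(2) le_imp_less_Suc
    by blast
  have "E \<subseteq> \<Union>((\<lambda>x. cball x (r/2)) ` X)"
  proof
    fix y assume y: "y \<in> E"
    show "y \<in> \<Union>((\<lambda>x. cball x (r/2)) ` X)"
    proof (rule ccontr)
      assume *: "y \<notin> \<Union>((\<lambda>x. cball x (r/2)) ` X)"
      then have far: "r / 2 < dist x y" if "x \<in> X" for x using that by force
      then have "y \<notin> X" using assms(2) by force
      have "P (insert y X)" using X(1) far y by (auto simp: P_def dist_commute)
      then show False using X(2)[of "insert y X"] fin(1)[OF X(1)] \<open>y \<notin> X\<close> by simp
    qed
  qed
  then have "covering_number r E \<le> card ((\<lambda>x. cball x (r/2)) ` X)"
    using fin(1)[OF X(1)] assms by (intro covering_number_le_card) auto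
  also have "\<dots> \<le> card X" using fin(1)[OF X(1)] card_image_le by auto
  finally show ?thesis using that[of X] X(1) fin(1)[OF X(1)] unfolding P_def by blast
qed

text \<open>Sort the points of \<open>X\<close> into fibres according to a covering set that
  contains their image. Two points of one fibre have images within \<open>r\<close>, so the sum of
  the squared fibre sizes is at most the number of close pairs; Cauchy-Schwarz does the
  rest.\<close>

lemma card_squared_le_covering_number_image:
  fixes f :: "'b \<Rightarrow> 'a::euclidean_space"
  assumes "bounded (f ` E)" "0 < r" "X \<subseteq> E" "finite X"
  shows "(card X)\<^sup>2 \<le> covering_number r (f ` E) * card {(x, y) \<in> X \<times> X. dist (f x) (f y) \<le> r}"
proof -
  obtain C where C: "finite C" "\<And>U. U \<in> C \<Longrightarrow> bounded U \<and> diameter U = r" "f ` E \<subseteq> \<Union>C"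
    "card C = covering_number r (f ` E)" using covering_number_attained[OF assms(1,2)] by blast
  have "\<forall>x\<in>X. \<exists>U\<in>C. f x \<in> U" using C(3) assms(3) by auto
  then obtain c where c: "\<And>x. x \<in> X \<Longrightarrow> c x \<in> C \<and> f x \<in> c x" by metis
  let ?F = "\<lambda>U. {x \<in> X. c x = U}"
  have "X = (\<Union>U\<in>C. ?F U)" using c by auto
  moreover have "card (\<Union>U\<in>C. ?F U) = (\<Sum>U\<in>C. card (?F U))"
    using C(1) assms(4) by (intro card_UN_disjoint) auto
  ultimately have "card X = (\<Sum>U\<in>C. card (?F U))" by metis
  then have "real (card X) ^ 2 = (\<Sum>U\<in>C. real (card (?F U)))\<^sup>2" by simp
  also have "\<dots> \<le> real (card C) * (\<Sum>U\<in>C. (real (card (?F U)))\<^sup>2)"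
    using sum_squared_le_sum_of_squares[of "\<lambda>U. real (card (?F U))" C] C(1)
    by (cases "C = {}") (simp_all add: mult.commute)
  also have "(\<Sum>U\<in>C. (real (card (?F U)))\<^sup>2) = real (card (\<Union>U\<in>C. ?F U \<times> ?F U))"
    using C(1) assms(4) by (subst card_UN_disjoint) (auto simp: power2_eq_square)
  also have "\<dots> \<le> real (card {(x, y) \<in> X \<times> X. dist (f x) (f y) \<le> r})"
  proof -
    have "dist (f x) (f y) \<le> r" if "x \<in> X" "y \<in> X" "c x = c y" for x y
      using diameter_bounded_bound[of "c x" "f x" "f y"] c[of x] c[of y] C(2)[of "c x"] that by auto
    then have "(\<Union>U\<in>C. ?F U \<times> ?F U) \<subseteq> {(x, y) \<in> X \<times> X. dist (f x) (f y) \<le> r}" by auto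
    moreover have "finite {(x, y) \<in> X \<times> X. dist (f x) (f y) \<le> r}"
      by (rule finite_subset[of _ "X \<times> X"]) (use assms(4) in auto)
    ultimately show ?thesis by (simp add: card_mono)
  qed
  finally have "real (card X) ^ 2 \<le> real (card C) * real (card {(x, y) \<in> X \<times> X. dist (f x) (f y) \<le> r})"
    by (simp add: mult_left_mono)
  then have "real ((card X)\<^sup>2) \<le> real (card C * card {(x, y) \<in> X \<times> X. dist (f x) (f y) \<le> r})"
    by simp
  then show ?thesis unfolding C(4) of_nat_le_iff .
qed

subsection \<open>Box dimensions along dyadic scales\<close>

lemma dyadic_bracket:
  fixes r :: real
  assumes "0 < r" "r \<le> 1"
  obtains k where "(1/2)^(Suc k) < r" "r \<le> (1/2)^k"
proof -
  obtain j where "(1/2)^j < r" using real_arch_pow_inv[of r "1/2"] assms by auto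
  define l where "l = (LEAST j. (1/2::real)^j < r)"
  have l: "(1/2)^l < r" unfolding l_def by (rule LeastI) fact
  then have "l \<noteq> 0" using assms by (cases l) auto
  then obtain k where k: "l = Suc k" by (cases l) auto
  have "\<not> (1/2)^k < r" using not_less_Least[of k "\<lambda>j. (1/2::real)^j < r"] k l_def by auto
  then show ?thesis using that[of k] l k by auto
qed

text \<open>The quotient from the box dimensions at \<open>r = (1/2)^k\<close>. At
  \<open>k = 0\<close> division by zero gives 0, which affects no limit.\<close>

abbreviation (input) dyadic_ratio :: "'a::metric_space set \<Rightarrow> nat \<Rightarrow> real" where
  "dyadic_ratio E k \<equiv> ln (real (covering_number ((1/2)^k) E)) / (real k * ln 2)"

lemma filterlim_half_power: "filterlim (\<lambda>k::nat. (1/2::real)^k) (at_right 0) sequentially"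
  unfolding filterlim_at by (auto intro!: LIMSEQ_realpow_zero)

lemma ln_half_power: "- ln ((1/2::real)^k) = real k * ln 2"
  by (simp add: ln_realpow ln_div)

lemma dyadic_ratio_nonneg:
  fixes E :: "'a::euclidean_space set"
  assumes "bounded E" "E \<noteq> {}"
  shows "0 \<le> dyadic_ratio E k"
  using covering_number_pos[OF assms(1) _ assms(2), of "(1/2)^k"] by simp

text \<open>Passing to a sequence can only lower the limsup. Conversely, if
  \<open>(1/2)^(k+1) < r \<le> (1/2)^k\<close>, the covering number at \<open>r\<close> is at most
  the one at \<open>(1/2)^(k+2)\<close>, and replacing \<open>- ln r\<close> by
  \<open>k * ln 2\<close> costs a factor \<open>(k+2)/k\<close> in total.\<close>

lemma upper_box_dim_dyadic:
  fixes E :: "'a::euclidean_space set"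
  assumes E: "bounded E" "E \<noteq> {}"
  shows "upper_box_dim E = limsup (\<lambda>k. ereal (dyadic_ratio E k))"
proof (rule antisym)
  note pos = covering_number_pos[OF E(1) _ E(2)]
  show "limsup (\<lambda>k. ereal (dyadic_ratio E k)) \<le> upper_box_dim E"
    unfolding Limsup_le_iff
  proof (intro allI impI)
    fix y assume "upper_box_dim E < y"
    then have "eventually (\<lambda>r. ereal (ln (real (covering_number r E)) / - ln r) < y) (at_right 0)"
      unfolding upper_box_dim_def by (rule Limsup_lessD)
    from eventually_compose_filterlim[OF this filterlim_half_power]
    show "\<forall>\<^sub>F k in sequentially. ereal (dyadic_ratio E k) < y"
      by (simp only: ln_half_power)
  qed
  show "upper_box_dim E \<le> limsup (\<lambda>k. ereal (dyadic_ratio E k))"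
    unfolding upper_box_dim_def Limsup_le_iff
  proof (intro allI impI)
    fix y assume y: "limsup (\<lambda>k. ereal (dyadic_ratio E k)) < y"
    then obtain z where z: "limsup (\<lambda>k. ereal (dyadic_ratio E k)) < ereal z" "ereal z < y"
      using ereal_dense2 by blast
    \<comment> \<open>The gap between \<open>z\<close> and \<open>w\<close> absorbs the factor
      \<open>(k+2)/k\<close>, which tends to 1.\<close>
    from z(2) obtain w where w: "ereal z < ereal w" "ereal w < y"
      using ereal_dense2 by blast
    have ev: "\<forall>\<^sub>F k in sequentially. dyadic_ratio E k < z"
      using Limsup_lessD[OF z(1)] by simp
    then obtain k0 where "dyadic_ratio E k0 < z" by (auto simp: eventually_sequentially)
    then have z0: "0 < z" using dyadic_ratio_nonneg[OF E, of k0] by simp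
    have "(\<lambda>k. z * (real (k+2) / real k)) \<longlonglongrightarrow> z * 1"
      by (intro tendsto_mult tendsto_const) real_asymp
    then have "\<forall>\<^sub>F k in sequentially. z * (real (k+2) / real k) < w"
      using w(1) by (intro order_tendstoD(2)) auto
    moreover have "\<forall>\<^sub>F k in sequentially. dyadic_ratio E (k+2) < z"
      using ev by (subst eventually_sequentially_seg)
    moreover have "\<forall>\<^sub>F k in sequentially. (1::nat) \<le> k" by (rule eventually_ge_at_top)
    ultimately have "\<forall>\<^sub>F k in sequentially. z * (real (k+2) / real k) < w \<and> dyadic_ratio E (k+2) < z \<and> 1 \<le> k"
      by eventually_elim auto
    then obtain K where K: "\<And>k. K \<le> k \<Longrightarrow> z * (real (k+2) / real k) < w \<and> dyadic_ratio E (k+2) < z \<and> 1 \<le> k"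
      unfolding eventually_sequentially by blast
    have "ereal (ln (real (covering_number r E)) / - ln r) < y" if r: "0 < r" "r < (1/2)^K" for r
    proof -
      have "r \<le> 1" using r(2) power_le_one[of "1/2::real" K] by linarith
      then obtain k where k: "(1/2)^(Suc k) < r" "r \<le> (1/2)^k" using r(1) dyadic_bracket by blast
      have "K \<le> k"
      proof (rule ccontr)
        assume "\<not> K \<le> k"
        then have "(1/2::real)^K \<le> (1/2)^(Suc k)" by (intro power_decreasing) auto
        then show False using k(1) r(2) by linarith
      qed
      note kk = K[OF this]
      have lnr: "real k * ln 2 \<le> - ln r"
        using k(2) r(1) ln_half_power[of k] by (metis ln_le_cancel_iff neg_le_iff_le zero_less_power half_gt_zero_iff zero_less_one)
      have kln: "0 < real k * ln 2" using kk by simp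
      then have "0 < - ln r" using lnr by linarith
      have "covering_number r E \<le> covering_number ((1/2)^(k+2)) E"
        using k(1) by (intro covering_number_antimono_radius[OF E(1)]) auto
      then have "ln (real (covering_number r E)) \<le> ln (real (covering_number ((1/2)^(k+2)) E))"
        using pos[OF r(1)] by simp
      also have "\<dots> = dyadic_ratio E (k+2) * (real (k+2) * ln 2)" by simp
      also have "\<dots> \<le> z * (real (k+2) * ln 2)" using kk by (intro mult_right_mono) auto
      finally have "ln (real (covering_number r E)) / - ln r \<le> z * (real (k+2) * ln 2) / - ln r"
        using lnr kln by (intro divide_right_mono) auto
      also have "z * (real (k+2) * ln 2) / - ln r \<le> z * (real (k+2) * ln 2) / (real k * ln 2)"
        using lnr kln z0 kk \<open>0 < - ln r\<close> by (intro divide_left_mono mult_pos_pos) auto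
      also have "\<dots> = z * (real (k+2) / real k)" by simp
      also have "\<dots> < w" using kk by blast
      finally show ?thesis using w(2) by (meson less_ereal.simps(1) less_trans)
    qed
    then show "\<forall>\<^sub>F r in at_right 0. ereal (ln (real (covering_number r E)) / - ln r) < y"
      unfolding eventually_at_right_field by (intro exI[of _ "(1/2)^K"]) auto
  qed
qed

text \<open>The mirror image of the upper case: if \<open>(1/2)^(k+2) < r \<le> (1/2)^(k+1)\<close>,
  the covering number at \<open>r\<close> is at least the one at \<open>(1/2)^k\<close>, while
  \<open>- ln r \<le> (k+2) * ln 2\<close>. The loss is a factor \<open>k/(k+2)\<close>.\<close>

lemma lower_box_dim_dyadic:
  fixes E :: "'a::euclidean_space set"
  assumes E: "bounded E" "E \<noteq> {}"
  shows "lower_box_dim E = liminf (\<lambda>k. ereal (dyadic_ratio E k))"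
proof (rule antisym)
  note pos = covering_number_pos[OF E(1) _ E(2)]
  show "lower_box_dim E \<le> liminf (\<lambda>k. ereal (dyadic_ratio E k))"
    unfolding le_Liminf_iff
  proof (intro allI impI)
    fix y assume "y < lower_box_dim E"
    then have "eventually (\<lambda>r. y < ereal (ln (real (covering_number r E)) / - ln r)) (at_right 0)"
      unfolding lower_box_dim_def by (rule less_LiminfD)
    from eventually_compose_filterlim[OF this filterlim_half_power]
    show "\<forall>\<^sub>F k in sequentially. y < ereal (dyadic_ratio E k)"
      by (simp only: ln_half_power)
  qed
  show "liminf (\<lambda>k. ereal (dyadic_ratio E k)) \<le> lower_box_dim E"
    unfolding lower_box_dim_def le_Liminf_iff
  proof (intro allI impI)
    fix y assume y: "y < liminf (\<lambda>k. ereal (dyadic_ratio E k))"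
    show "\<forall>\<^sub>F r in at_right 0. y < ereal (ln (real (covering_number r E)) / - ln r)"
    \<comment> \<open>For negative \<open>y\<close> it suffices that the quotient is nonnegative for
      \<open>r < 1\<close>. Otherwise the intermediate value \<open>z\<close> is positive, as the
      comparison of denominators requires.\<close>
    proof (cases "y < 0")
      case True
      have "y < ereal (ln (real (covering_number r E)) / - ln r)" if r: "0 < r" "r < 1" for r
      proof -
        have "0 \<le> ln (real (covering_number r E)) / - ln r"
          using pos[OF r(1)] r by (intro divide_nonneg_nonneg) auto
        then show ?thesis using True by (meson ereal_less_eq(5) less_le_trans)
      qed
      then show ?thesis unfolding eventually_at_right_field by (intro exI[of _ 1]) auto
    next
      case False
      obtain z where z: "y < ereal z" "ereal z < liminf (\<lambda>k. ereal (dyadic_ratio E k))"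
        using y ereal_dense2 by blast
      have z0: "0 < z" using z(1) False by (meson ereal_less(2) le_less_trans not_less)
      obtain w where w: "y < ereal w" "ereal w < ereal z" using z(1) ereal_dense2 by blast
      have ev: "\<forall>\<^sub>F k in sequentially. z < dyadic_ratio E k"
        using less_LiminfD[OF z(2)] by simp
      have "(\<lambda>k. z * (real k / real (k+2))) \<longlonglongrightarrow> z * 1"
        by (intro tendsto_mult tendsto_const) real_asymp
      then have "\<forall>\<^sub>F k in sequentially. w < z * (real k / real (k+2))"
        using w(2) by (intro order_tendstoD(1)) auto
      moreover have "\<forall>\<^sub>F k in sequentially. (1::nat) \<le> k" by (rule eventually_ge_at_top)
      ultimately have "\<forall>\<^sub>F k in sequentially. w < z * (real k / real (k+2)) \<and> z < dyadic_ratio E k \<and> 1 \<le> k"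
        using ev by eventually_elim auto
      then obtain K where K: "\<And>k. K \<le> k \<Longrightarrow> w < z * (real k / real (k+2)) \<and> z < dyadic_ratio E k \<and> 1 \<le> k"
        unfolding eventually_sequentially by blast
      have "y < ereal (ln (real (covering_number r E)) / - ln r)" if r: "0 < r" "r < (1/2)^(Suc K)" for r
      proof -
        have "r \<le> 1" using r(2) power_le_one[of "1/2::real" "Suc K"] by linarith
        then obtain l where l: "(1/2)^(Suc l) < r" "r \<le> (1/2)^l" using r(1) dyadic_bracket by blast
        have "Suc K \<le> l"
        proof (rule ccontr)
          assume "\<not> Suc K \<le> l"
          then have "(1/2::real)^(Suc K) \<le> (1/2)^(Suc l)" by (intro power_decreasing) auto
          then show False using l(1) r(2) by linarith
        qed
        then obtain k where k: "l = Suc k" "K \<le> k" by (cases l) auto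
        note kk = K[OF k(2)]
        have lnr: "- ln r \<le> real (k+2) * ln 2"
        proof -
          have "(1/2)^(k+2) < r" using l(1) k(1) by simp
          then have "ln ((1/2)^(k+2)) \<le> ln r" using r(1) by (subst ln_le_cancel_iff) auto
          then show ?thesis using ln_half_power[of "k+2"] by linarith
        qed
        have "0 < - ln r"
        proof -
          have "r \<le> (1/2)^1" using l(2) k(1) power_decreasing[of 1 l "1/2::real"] by simp
          then show ?thesis using r(1) by simp
        qed
        have "covering_number ((1/2)^k) E \<le> covering_number r E"
          using l(2) k(1) r(1) by (intro covering_number_antimono_radius[OF E(1)]) auto
        then have "ln (real (covering_number ((1/2)^k) E)) \<le> ln (real (covering_number r E))"
          using pos[of "(1/2)^k"] by simp
        moreover have "z * (real k * ln 2) \<le> ln (real (covering_number ((1/2)^k) E))"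
        proof -
          have "0 < real k * ln 2" "z < dyadic_ratio E k" using kk by auto
          then show ?thesis by (simp only: pos_less_divide_eq less_imp_le)
        qed
        ultimately have "z * (real k * ln 2) / - ln r \<le> ln (real (covering_number r E)) / - ln r"
          using \<open>0 < - ln r\<close> by (intro divide_right_mono) auto
        moreover have "z * (real k * ln 2) / (real (k+2) * ln 2) \<le> z * (real k * ln 2) / - ln r"
          using lnr \<open>0 < - ln r\<close> z0 by (intro divide_left_mono mult_pos_pos) auto
        moreover have "z * (real k * ln 2) / (real (k+2) * ln 2) = z * (real k / real (k+2))" by simp
        ultimately have "w < ln (real (covering_number r E)) / - ln r" using kk by linarith
        then show ?thesis using w(1) by (meson less_ereal.simps(1) less_trans)
      qed
      then show ?thesis
        unfolding eventually_at_right_field by (intro exI[of _ "(1/2)^(Suc K)"]) auto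
    qed
  qed
qed

section \<open>Monotonicity, closures and comparison of box dimensions\<close>

lemma upper_box_dim_mono:
  fixes E :: "'a::euclidean_space set"
  assumes "E \<subseteq> E'" "bounded E'" "E \<noteq> {}"
  shows "upper_box_dim E \<le> upper_box_dim E'"
proof -
  have E: "bounded E" using assms bounded_subset by blast
  have "dyadic_ratio E k \<le> dyadic_ratio E' k" for k
    using covering_number_mono[OF assms(1,2), of "(1/2)^k"] covering_number_pos[OF E _ assms(3), of "(1/2)^k"]
    by (intro divide_right_mono) auto
  moreover have "E' \<noteq> {}" using assms by auto
  ultimately show ?thesis
    using E assms(2,3) by (simp add: upper_box_dim_dyadic Limsup_mono)
qed

lemma upper_box_dim_closure_le:
  fixes E :: "'a::euclidean_space set"
  assumes "bounded E" "E \<noteq> {}"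
  shows "upper_box_dim (closure E) \<le> upper_box_dim E"
proof -
  have c: "bounded (closure E)" "closure E \<noteq> {}" using assms by auto
  have "dyadic_ratio (closure E) k \<le> dyadic_ratio E k" for k
    using covering_number_closure_le[OF assms(1), of "(1/2)^k"] covering_number_pos[OF c(1) _ c(2), of "(1/2)^k"]
    by (intro divide_right_mono) auto
  then show ?thesis using c assms by (simp add: upper_box_dim_dyadic Limsup_mono)
qed

lemma upper_box_dim_nonneg:
  fixes E :: "'a::euclidean_space set"
  assumes "bounded E" "E \<noteq> {}"
  shows "0 \<le> upper_box_dim E"
  unfolding upper_box_dim_dyadic[OF assms] using dyadic_ratio_nonneg[OF assms]
  by (intro le_Limsup) auto

lemma lower_box_dim_nonneg:
  fixes E :: "'a::euclidean_space set"
  assumes "bounded E" "E \<noteq> {}"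
  shows "0 \<le> lower_box_dim E"
  unfolding lower_box_dim_dyadic[OF assms] using dyadic_ratio_nonneg[OF assms]
  by (intro Liminf_bounded) auto

text \<open>The probabilistic argument only yields an eventual comparison of dyadic ratios up to a
  small error. If a claim failed, there would be reals \<open>z < w\<close> strictly between its two
  sides, and the error \<open>w - z\<close> gives a contradiction.\<close>

lemma box_dim_transfer:
  fixes E :: "'a::euclidean_space set" and E' :: "'b::euclidean_space set"
  assumes E: "bounded E" "E \<noteq> {}" and E': "bounded E'" "E' \<noteq> {}" and "0 < s"
    and le: "\<And>\<epsilon>. 0 < \<epsilon> \<Longrightarrow>
      \<forall>\<^sub>F k in sequentially. s * dyadic_ratio E k - \<epsilon> \<le> dyadic_ratio E' k"
  shows "ereal s * upper_box_dim E \<le> upper_box_dim E'"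
    and "ereal s * lower_box_dim E \<le> lower_box_dim E'"
proof -
  \<comment> \<open>Division by \<open>s\<close> in a form that also allows \<open>x\<close> to be
    infinite.\<close>
  have scale: "ereal (z / s) < x" if "ereal z < ereal s * x" for x z
  proof (rule ccontr)
    assume "\<not> ereal (z / s) < x"
    then have "ereal s * x \<le> ereal s * ereal (z / s)" using \<open>0 < s\<close> by (intro ereal_mult_left_mono) auto
    then show False using that \<open>0 < s\<close> by (simp add: not_less)
  qed
  show "ereal s * upper_box_dim E \<le> upper_box_dim E'"
  proof (rule ccontr)
    assume "\<not> ?thesis"
    then have "upper_box_dim E' < ereal s * upper_box_dim E" by simp
    then obtain z where z: "upper_box_dim E' < ereal z" "ereal z < ereal s * upper_box_dim E"
      using ereal_dense2 by blast
    obtain w where w: "ereal z < ereal w" "ereal w < ereal s * upper_box_dim E"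
      using z(2) ereal_dense2 by blast
    have "\<forall>\<^sub>F k in sequentially. dyadic_ratio E' k < z"
      using Limsup_lessD[OF z(1)[unfolded upper_box_dim_dyadic[OF E']]] by simp
    moreover have "\<forall>\<^sub>F k in sequentially. s * dyadic_ratio E k - (w - z) \<le> dyadic_ratio E' k"
      using w(1) by (intro le) auto
    ultimately have "\<forall>\<^sub>F k in sequentially. ereal (dyadic_ratio E k) \<le> ereal (w / s)"
    proof eventually_elim
      case (elim k)
      then have "dyadic_ratio E k * s \<le> w" by (simp add: mult.commute)
      then show ?case using \<open>0 < s\<close> by (simp add: pos_le_divide_eq)
    qed
    then have "upper_box_dim E \<le> ereal (w / s)"
      unfolding upper_box_dim_dyadic[OF E] by (rule Limsup_bounded)
    then show False using scale[OF w(2)] by simp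
  qed
  show "ereal s * lower_box_dim E \<le> lower_box_dim E'"
  proof (rule ccontr)
    assume "\<not> ?thesis"
    then have "lower_box_dim E' < ereal s * lower_box_dim E" by simp
    then obtain z where z: "lower_box_dim E' < ereal z" "ereal z < ereal s * lower_box_dim E"
      using ereal_dense2 by blast
    obtain w where w: "ereal z < ereal w" "ereal w < ereal s * lower_box_dim E"
      using z(2) ereal_dense2 by blast
    have "\<forall>\<^sub>F k in sequentially. w / s < dyadic_ratio E k"
      using less_LiminfD[OF scale[OF w(2), unfolded lower_box_dim_dyadic[OF E]]] by simp
    moreover have "\<forall>\<^sub>F k in sequentially. s * dyadic_ratio E k - (w - z) \<le> dyadic_ratio E' k"
      using w(1) by (intro le) auto
    ultimately have "\<forall>\<^sub>F k in sequentially. ereal z \<le> ereal (dyadic_ratio E' k)"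
    proof eventually_elim
      case (elim k)
      then have "w < s * dyadic_ratio E k" using \<open>0 < s\<close> by (simp add: pos_divide_less_eq mult.commute)
      then show ?case using elim by simp
    qed
    then have "ereal z \<le> lower_box_dim E'"
      unfolding lower_box_dim_dyadic[OF E'] by (rule Liminf_bounded)
    then show False using z(1) by simp
  qed
qed

subsection \<open>Slabs under the invariant measure\<close>

text \<open>The columns are an orthonormal basis of \<open>V\<close> followed through by one of its
  orthogonal complement; \<open>J\<close> marks the columns that lie in \<open>V\<close>.\<close>

lemma exists_adapted_orthogonal_matrix:
  fixes V :: "(real^'n) set"
  assumes V: "subspace V"
  obtains A :: "real^'n^'n" and J where "orthogonal_matrix A" "card J = dim V"
    "\<And>j. j \<in> J \<Longrightarrow> column j A \<in> V"
proof -
  obtain B where B: "B \<subseteq> V" "pairwise orthogonal B" "\<And>x. x \<in> B \<Longrightarrow> norm x = 1"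
    "independent B" "card B = dim V" "span B = V"
    using orthonormal_basis_subspace[OF V] by blast
  let ?W = "{y \<in> UNIV. \<forall>x\<in>V. orthogonal x y}"
  have W: "subspace ?W" using subspace_orthogonal_to_vectors[of V] by simp
  have dimW: "dim ?W + dim V = CARD('n)"
    using dim_subspace_orthogonal_to_vectors[OF V subspace_UNIV] by simp
  obtain B' where B': "B' \<subseteq> ?W" "pairwise orthogonal B'" "\<And>x. x \<in> B' \<Longrightarrow> norm x = 1"
    "independent B'" "card B' = dim ?W" "span B' = ?W"
    using orthonormal_basis_subspace[OF W] by blast
  have fin: "finite B" "finite B'" using B(4) B'(4) by (auto simp: independent_imp_finite)
  have cross: "orthogonal x y" if "x \<in> B" "y \<in> B'" for x y using that B(1) B'(1) by auto
  have disj: "B \<inter> B' = {}"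
  proof (rule ccontr)
    assume "B \<inter> B' \<noteq> {}"
    then obtain x where "x \<in> B" "x \<in> B'" by auto
    then show False using cross[of x x] B(3)[of x] by (auto simp: orthogonal_self)
  qed
  have "card (B \<union> B') = CARD('n)"
    using card_Un_disjoint[OF fin disj] B(5) B'(5) dimW by simp
  then obtain f where f: "bij_betw f (UNIV::'n set) (B \<union> B')"
    using finite_same_card_bij[of "UNIV::'n set" "B \<union> B'"] fin by auto
  have norm1: "norm (f i) = 1" for i
    using bij_betwE[OF f] B(3) B'(3) by blast
  have orth: "orthogonal (f i) (f j)" if "i \<noteq> j" for i j
  proof -
    have "f i \<noteq> f j" using that f by (auto simp: bij_betw_def inj_on_def)
    moreover have "f i \<in> B \<union> B'" "f j \<in> B \<union> B'" using bij_betwE[OF f] by auto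
    ultimately show ?thesis
      using B(2) B'(2) cross orthogonal_commute unfolding pairwise_def by blast
  qed
  have col: "column j (\<chi> i j. f j $ i) = f j" for j by (simp add: column_def)
  show ?thesis
  proof
    show "orthogonal_matrix (\<chi> i j. f j $ i)"
      by (simp add: orthogonal_matrix_orthonormal_columns col norm1 orth)
    have "bij_betw f (f -` B) B"
      using f unfolding bij_betw_def by (auto simp: inj_on_def)
    then show "card (f -` B) = dim V" using B(5) bij_betw_same_card by metis
    show "column j (\<chi> i j. f j $ i) \<in> V" if "j \<in> f -` B" for j
      using that B(1) by (auto simp: col)
  qed
qed

lemma norm_orth_proj_measurable:
  fixes V :: "(real^'n) set"
  assumes "subspace V"
  shows "(\<lambda>x. norm (orth_proj V x)) \<in> borel_measurable borel"
  using linear_orth_proj[OF assms]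
  by (intro borel_measurable_continuous_onI continuous_intros linear_continuous_on)
    (simp add: linear_conv_bounded_linear)

text \<open>In orthonormal coordinates adapted to \<open>V\<close>, coordinates along
  \<open>V\<close> are at most \<open>\<rho>\<close> in modulus because the projection sees them,
  and the others are at most 1. The slab thus lies in a rotated box with these half-sides, and
  orthogonal maps preserve Lebesgue measure.\<close>

lemma emeasure_slab_le:
  fixes V :: "(real^'n) set"
  assumes V: "subspace V" and "0 \<le> \<rho>"
  shows "emeasure lborel {x \<in> cball 0 1. norm (orth_proj V x) \<le> \<rho>} \<le> ennreal (2 ^ CARD('n) * \<rho> ^ dim V)"
proof -
  obtain A :: "real^'n^'n" and J where A: "orthogonal_matrix A" "card J = dim V"
    "\<And>j. j \<in> J \<Longrightarrow> column j A \<in> V"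
    using exists_adapted_orthogonal_matrix[OF V] by blast
  define g where "g = (*v) A"
  have g: "orthogonal_transformation g"
    using A(1) by (simp add: g_def orthogonal_transformation_matrix)
  have coord: "g x \<bullet> column j A = x $ j" for x j
  proof -
    have "g x \<bullet> g (axis j 1) = x \<bullet> axis j 1" using g by (simp add: orthogonal_transformation_def)
    then show ?thesis by (simp add: g_def inner_axis matrix_vector_mul_component matrix_vector_mult_basis)
  qed
  have normcol: "norm (column j A) = 1" for j
    using A(1) by (simp add: orthogonal_matrix_orthonormal_columns)
  let ?S = "{x \<in> cball 0 1. norm (orth_proj V x) \<le> \<rho>}"
  have S[measurable]: "?S \<in> sets borel"
    using norm_orth_proj_measurable[OF V, measurable] by measurable
  define b :: "real^'n" where "b = (\<chi> j. if j \<in> J then \<rho> else 1)"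
  have "g -` ?S \<subseteq> cbox (- b) b"
  proof
    fix x assume x: "x \<in> g -` ?S"
    have "\<bar>x $ j\<bar> \<le> b $ j" for j
    proof (cases "j \<in> J")
      case True
      have "orthogonal (g x - orth_proj V (g x)) (column j A)"
        using orth_proj_props(2)[OF V A(3)[OF True]] .
      then have "x $ j = orth_proj V (g x) \<bullet> column j A"
        using coord[of x j] by (simp add: orthogonal_def inner_diff_left)
      then have "\<bar>x $ j\<bar> \<le> norm (orth_proj V (g x)) * norm (column j A)"
        using Cauchy_Schwarz_ineq2 by metis
      then show ?thesis using x True by (simp add: b_def normcol)
    next
      case False
      have "\<bar>x $ j\<bar> \<le> norm x" by (rule component_le_norm_cart)
      also have "\<dots> = norm (g x)" using orthogonal_transformation_norm[OF g] by simp
      finally show ?thesis using x False by (simp add: b_def)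
    qed
    then show "x \<in> cbox (- b) b" by (auto simp: mem_box_cart abs_le_iff minus_le_iff)
  qed
  have "linear g" using g by (simp add: orthogonal_transformation_linear)
  then have gm[measurable]: "g \<in> measurable lborel lborel"
    by (simp add: linear_conv_bounded_linear borel_measurable_continuous_onI linear_continuous_on)
  have "emeasure lborel ?S = emeasure (distr lborel lborel g) ?S"
    by (simp add: lborel_distr_orthogonal[OF g])
  also have "\<dots> = emeasure lborel (g -` ?S)"
    using S by (subst emeasure_distr[OF gm]) simp_all
  also have "\<dots> \<le> emeasure lborel (cbox (- b) b)"
    using \<open>g -` ?S \<subseteq> cbox (- b) b\<close> by (intro emeasure_mono) auto
  also have "\<dots> = ennreal (measure lborel (cbox (- b) b))"
    using emeasure_bounded_finite[OF bounded_cbox, of "- b" b] by (intro emeasure_eq_ennreal_measure) auto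
  also have "measure lborel (cbox (- b) b) = (\<Prod>j\<in>UNIV. 2 * b $ j)"
  proof -
    have "0 \<in> cbox (- b) b" using assms(2) by (auto simp: mem_box_cart b_def)
    then show ?thesis by (subst content_cbox_cart) auto
  qed
  also have "\<dots> = 2 ^ CARD('n) * \<rho> ^ dim V"
    by (simp add: prod.distrib b_def prod.If_cases A(2))
  finally show ?thesis .
qed

section \<open>Measurability, invariance and the probability of a slab\<close>

text \<open>Joint measurability is what permits exchanging the integrals over \<open>x\<close> and
  \<open>V\<close>. The map from \<open>V\<close> to its projection matrix is measurable by
  construction of \<open>grassmann_borel\<close>, and the norm of \<open>A *v x\<close> is
  continuous in \<open>(x, A)\<close>.\<close>

lemma norm_orth_proj_pair_measurable:
  assumes "sets \<gamma> = sets (grassmann_borel m :: (real^'n) set measure)"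
  shows "(\<lambda>(x, V). norm (orth_proj V x)) \<in> borel_measurable (borel \<Otimes>\<^sub>M \<gamma>)"
proof -
  have sp: "space \<gamma> = grassmannian m"
    using sets_eq_imp_space_eq[OF assms] by (simp add: grassmann_borel_def)
  have M: "(\<lambda>V. matrix (orth_proj V)) \<in> measurable \<gamma> (borel :: (real^'n^'n) measure)"
  proof -
    have "(\<lambda>V. matrix (orth_proj V)) \<in> measurable (grassmann_borel m) (borel :: (real^'n^'n) measure)"
      unfolding grassmann_borel_def by (rule measurable_vimage_algebra1) auto
    then show ?thesis using measurable_cong_sets[OF assms refl] by blast
  qed
  have "(\<lambda>(x :: real^'n, A :: real^'n^'n). norm (A *v x)) \<in> borel_measurable borel"
    unfolding matrix_vector_mult_def case_prod_beta
    by (intro borel_measurable_continuous_onI continuous_intros)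
  then have "(\<lambda>(x :: real^'n, A :: real^'n^'n). norm (A *v x)) \<in> borel_measurable (borel \<Otimes>\<^sub>M borel)"
    by (simp add: borel_prod)
  moreover have "(\<lambda>(x, V). (x, matrix (orth_proj V))) \<in> measurable (borel \<Otimes>\<^sub>M \<gamma>) (borel \<Otimes>\<^sub>M (borel :: (real^'n^'n) measure))"
    using M by measurable
  ultimately have "(\<lambda>p. (\<lambda>(x :: real^'n, A :: real^'n^'n). norm (A *v x)) ((\<lambda>(x, V). (x, matrix (orth_proj V))) p))
      \<in> borel_measurable (borel \<Otimes>\<^sub>M \<gamma>)"
    by (rule measurable_compose[rotated])
  moreover have "(\<lambda>(x :: real^'n, A :: real^'n^'n). norm (A *v x)) ((\<lambda>(x, V). (x, matrix (orth_proj V))) p)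
      = (case p of (x, V) \<Rightarrow> norm (orth_proj V x))" if "p \<in> space (borel \<Otimes>\<^sub>M \<gamma>)" for p
  proof -
    have "snd p \<in> space \<gamma>" using that by (simp add: space_pair_measure mem_Times_iff)
    then have "subspace (snd p)" using sp by (simp add: grassmannian_def)
    then have "linear (orth_proj (snd p))" by (rule linear_orth_proj)
    then show ?thesis by (simp add: matrix_works case_prod_beta)
  qed
  ultimately show ?thesis by (simp cong: measurable_cong)
qed

lemma norm_orth_proj_measurable_grassmann:
  assumes "sets \<gamma> = sets (grassmann_borel m :: (real^'n) set measure)"
  shows "(\<lambda>V. norm (orth_proj V x)) \<in> borel_measurable \<gamma>"
  using measurable_compose[OF measurable_Pair1' norm_orth_proj_pair_measurable[OF assms], of x] by simp

lemma grassmann_slab_rotate: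
  fixes x y :: "real^'n"
  assumes \<gamma>: "invariant_grassmann_measure m \<gamma>" and xy: "norm x = norm y"
  shows "emeasure \<gamma> {V \<in> space \<gamma>. norm (orth_proj V x) \<le> \<rho>} =
    emeasure \<gamma> {V \<in> space \<gamma>. norm (orth_proj V y) \<le> \<rho>}"
proof -
  have s: "sets \<gamma> = sets (grassmann_borel m)" using \<gamma> by (simp add: invariant_grassmann_measure_def)
  note [measurable] = norm_orth_proj_measurable_grassmann[OF s]
  have sp: "space \<gamma> = grassmannian m"
    using sets_eq_imp_space_eq[OF s] by (simp add: grassmann_borel_def)
  obtain g where g: "orthogonal_transformation g" "g x = y"
    using orthogonal_transformation_exists[OF xy] by blast
  have gm: "(`) g \<in> measurable \<gamma> \<gamma>"
    using measurable_orthogonal_image_grassmann[OF g(1)] measurable_cong_sets[OF s s] by blast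
  have "emeasure \<gamma> {V \<in> space \<gamma>. norm (orth_proj V y) \<le> \<rho>} =
      emeasure (distr \<gamma> \<gamma> ((`) g)) {V \<in> space \<gamma>. norm (orth_proj V y) \<le> \<rho>}"
    using \<gamma> g(1) by (simp add: invariant_grassmann_measure_def)
  also have "\<dots> = emeasure \<gamma> ((`) g -` {V \<in> space \<gamma>. norm (orth_proj V y) \<le> \<rho>} \<inter> space \<gamma>)"
    by (rule emeasure_distr[OF gm]) measurable
  also have "(`) g -` {V \<in> space \<gamma>. norm (orth_proj V y) \<le> \<rho>} \<inter> space \<gamma> =
      {V \<in> space \<gamma>. norm (orth_proj V x) \<le> \<rho>}"
  proof -
    have "norm (orth_proj (g ` V) y) = norm (orth_proj V x)" if "V \<in> space \<gamma>" for V
      using that orth_proj_orthogonal_image[OF g(1), of V x] orthogonal_transformation_norm[OF g(1)] g(2)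
      by (simp add: sp grassmannian_def)
    then show ?thesis using measurable_space[OF gm] by auto
  qed
  finally show ?thesis by simp
qed

text \<open>Rescaling \<open>x\<close> to the length of \<open>y\<close> multiplies both sides of
  the slab inequality by the same factor, which reduces the claim to vectors of equal
  length.\<close>

lemma grassmann_slab_scale:
  fixes x y :: "real^'n"
  assumes \<gamma>: "invariant_grassmann_measure m \<gamma>" and xy: "x \<noteq> 0" "y \<noteq> 0"
  shows "emeasure \<gamma> {V \<in> space \<gamma>. norm (orth_proj V x) \<le> \<rho> * norm x} =
    emeasure \<gamma> {V \<in> space \<gamma>. norm (orth_proj V y) \<le> \<rho> * norm y}"
proof -
  have s: "sets \<gamma> = sets (grassmann_borel m)" using \<gamma> by (simp add: invariant_grassmann_measure_def)
  have sp: "space \<gamma> = grassmannian m"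
    using sets_eq_imp_space_eq[OF s] by (simp add: grassmann_borel_def)
  let ?t = "norm y / norm x"
  have t: "?t > 0" using xy by simp
  have "norm (orth_proj V (?t *\<^sub>R x)) \<le> \<rho> * norm y \<longleftrightarrow> norm (orth_proj V x) \<le> \<rho> * norm x"
    if "V \<in> space \<gamma>" for V
  proof -
    have "linear (orth_proj V)" using that sp by (intro linear_orth_proj) (simp add: grassmannian_def)
    then have "norm (orth_proj V (?t *\<^sub>R x)) = ?t * norm (orth_proj V x)"
      using t by (simp add: linear_scale)
    moreover have "\<rho> * norm y = ?t * (\<rho> * norm x)" using xy by simp
    ultimately show ?thesis using t by (simp only: mult_le_cancel_left_pos)
  qed
  then have "{V \<in> space \<gamma>. norm (orth_proj V x) \<le> \<rho> * norm x} =
      {V \<in> space \<gamma>. norm (orth_proj V (?t *\<^sub>R x)) \<le> \<rho> * norm y}" by auto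
  then show ?thesis using grassmann_slab_rotate[OF \<gamma>, of "?t *\<^sub>R x" y] xy by simp
qed

text \<open>An averaging argument: the probability that the projection of \<open>y\<close> has norm
  at most \<open>\<rho> * norm y\<close> is the same for all \<open>y \<noteq> 0\<close>.
  Integrating it over the unit ball and applying Fubini leaves, for each fixed \<open>V\<close>, the
  volume of a slab, which is bounded by a multiple of \<open>\<rho> ^ m\<close>.\<close>

lemma grassmann_slab_le:
  assumes \<gamma>: "invariant_grassmann_measure m (\<gamma> :: (real^'n) set measure)"
  obtains c where "0 < c"
    "\<And>x \<rho>. x \<noteq> 0 \<Longrightarrow> 0 \<le> \<rho> \<Longrightarrow>
      measure \<gamma> {V \<in> space \<gamma>. norm (orth_proj V x) \<le> \<rho>} \<le> c * (\<rho> / norm x) ^ m"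
proof -
  have s: "sets \<gamma> = sets (grassmann_borel m)" using \<gamma> by (simp add: invariant_grassmann_measure_def)
  have sp: "space \<gamma> = grassmannian m"
    using sets_eq_imp_space_eq[OF s] by (simp add: grassmann_borel_def)
  interpret prob_space \<gamma> using \<gamma> by (simp add: invariant_grassmann_measure_def)
  interpret P: pair_sigma_finite lborel \<gamma> by unfold_locales
  let ?B = "cball 0 1 :: (real^'n) set"
  have B: "0 < measure lborel ?B" by (simp add: content_cball_pos)
  have eB: "emeasure lborel ?B = ennreal (measure lborel ?B)"
    using emeasure_bounded_finite[of ?B] by (intro emeasure_eq_ennreal_measure) auto
  note pm = norm_orth_proj_pair_measurable[OF s, measurable]
  note vm = norm_orth_proj_measurable_grassmann[OF s, measurable]
  have main: "measure \<gamma> {V \<in> space \<gamma>. norm (orth_proj V x) \<le> \<rho> * norm x} * measure lborel ?B \<le> 2 ^ CARD('n) * \<rho> ^ m"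
    if x: "x \<noteq> 0" and \<rho>: "0 \<le> \<rho>" for x \<rho>
  proof -
    let ?h = "\<lambda>y. {V \<in> space \<gamma>. norm (orth_proj V y) \<le> \<rho> * norm y}"
    define Q where "Q = (\<lambda>(y :: real^'n, V). indicator {..1} (norm y) * indicator {..0} (norm (orth_proj V y) - \<rho> * norm y) :: ennreal)"
    have Qm: "Q \<in> borel_measurable (lborel \<Otimes>\<^sub>M \<gamma>)"
    proof -
      have [measurable]: "(\<lambda>p :: (real^'n) \<times> (real^'n) set. norm (orth_proj (snd p) (fst p))) \<in> borel_measurable (lborel \<Otimes>\<^sub>M \<gamma>)"
        using pm by (simp add: case_prod_beta cong: measurable_cong_sets)
      show ?thesis unfolding Q_def case_prod_beta by measurable
    qed
    have 1: "emeasure \<gamma> (?h x) * indicator ?B y \<le> (\<integral>\<^sup>+V. Q (y, V) \<partial>\<gamma>)" for y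
    proof -
      have "(\<integral>\<^sup>+V. Q (y, V) \<partial>\<gamma>) = (\<integral>\<^sup>+V. indicator ?B y * indicator (?h y) V \<partial>\<gamma>)"
        by (intro nn_integral_cong) (auto simp: Q_def indicator_def)
      also have "\<dots> = indicator ?B y * emeasure \<gamma> (?h y)"
        by (subst nn_integral_cmult) (auto simp: nn_integral_indicator)
      also have "indicator ?B y * emeasure \<gamma> (?h x) \<le> \<dots>"
      proof (cases "y = 0")
        \<comment> \<open>At the origin the slab is all of \<open>space \<gamma>\<close>, so here
          only an inequality holds.\<close>
        case True
        have "norm (orth_proj V 0) = 0" if "V \<in> space \<gamma>" for V :: "(real^'n) set"
          using that linear_0[OF linear_orth_proj[of V]] by (simp add: sp grassmannian_def)
        then have "?h y = space \<gamma>" using True by auto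
        then show ?thesis by (simp add: emeasure_space mult_left_mono)
      next
        case False
        then show ?thesis using grassmann_slab_scale[OF \<gamma> x False] by simp
      qed
      finally show ?thesis by (simp add: mult.commute)
    qed
    have 2: "(\<integral>\<^sup>+y. Q (y, V) \<partial>lborel) \<le> ennreal (2 ^ CARD('n) * \<rho> ^ m)" if "V \<in> space \<gamma>" for V
    proof -
      have V: "subspace V" "dim V = m" using that by (auto simp: sp grassmannian_def)
      note [measurable] = norm_orth_proj_measurable[OF V(1)]
      have "(\<integral>\<^sup>+y. Q (y, V) \<partial>lborel) \<le> (\<integral>\<^sup>+y. indicator {y \<in> ?B. norm (orth_proj V y) \<le> \<rho>} y \<partial>lborel)"
      proof (intro nn_integral_mono)
        fix y :: "real^'n"
        have "\<rho> * norm y \<le> \<rho> * 1" if "norm y \<le> 1" using that \<rho> by (rule mult_left_mono)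
        then show "Q (y, V) \<le> indicator {y \<in> ?B. norm (orth_proj V y) \<le> \<rho>} y"
          by (auto simp: Q_def indicator_def)
      qed
      also have "\<dots> = emeasure lborel {y \<in> ?B. norm (orth_proj V y) \<le> \<rho>}"
        by (intro nn_integral_indicator) measurable
      also have "\<dots> \<le> ennreal (2 ^ CARD('n) * \<rho> ^ m)"
        using emeasure_slab_le[OF V(1) \<rho>] V(2) by simp
      finally show ?thesis .
    qed
    have "emeasure \<gamma> (?h x) * emeasure lborel ?B = (\<integral>\<^sup>+y. emeasure \<gamma> (?h x) * indicator ?B y \<partial>lborel)"
      by (subst nn_integral_cmult_indicator) auto
    also have "\<dots> \<le> (\<integral>\<^sup>+y. (\<integral>\<^sup>+V. Q (y, V) \<partial>\<gamma>) \<partial>lborel)"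
      using 1 by (intro nn_integral_mono)
    also have "\<dots> = (\<integral>\<^sup>+V. (\<integral>\<^sup>+y. Q (y, V) \<partial>lborel) \<partial>\<gamma>)"
      using P.Fubini[OF Qm] by simp
    also have "\<dots> \<le> (\<integral>\<^sup>+V. ennreal (2 ^ CARD('n) * \<rho> ^ m) \<partial>\<gamma>)"
      using 2 by (intro nn_integral_mono) auto
    also have "\<dots> = ennreal (2 ^ CARD('n) * \<rho> ^ m)" by (simp add: emeasure_space_1)
    finally have "ennreal (measure \<gamma> (?h x) * measure lborel ?B) \<le> ennreal (2 ^ CARD('n) * \<rho> ^ m)"
      by (simp add: eB emeasure_eq_measure ennreal_mult)
    then show ?thesis using \<rho> by (simp add: ennreal_le_iff)
  qed
  show ?thesis
  proof
    show "0 < 2 ^ CARD('n) / measure lborel ?B" using B by simp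
    fix x :: "real^'n" and \<rho> :: real assume "x \<noteq> 0" "0 \<le> \<rho>"
    then show "measure \<gamma> {V \<in> space \<gamma>. norm (orth_proj V x) \<le> \<rho>} \<le> 2 ^ CARD('n) / measure lborel ?B * (\<rho> / norm x) ^ m"
      using main[of x "\<rho> / norm x"] B by (simp add: field_simps)
  qed
qed

subsection \<open>Box dimensions of projections\<close>

text \<open>Without ties the ranks are exactly \<open>1, ..., card X\<close>; ties only raise ranks,
  and \<open>h\<close> is decreasing. The induction adds a point of largest value, whose rank is the
  new cardinality, and no other rank drops.\<close>

lemma sum_rank_le:
  fixes f :: "'a \<Rightarrow> real" and h :: "nat \<Rightarrow> real"
  assumes "finite X" and h: "\<And>i j. 1 \<le> i \<Longrightarrow> i \<le> j \<Longrightarrow> h j \<le> h i"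
  shows "(\<Sum>y\<in>X. h (card {z \<in> X. f z \<le> f y})) \<le> (\<Sum>k=1..card X. h k)"
  using assms(1)
proof (induction X rule: finite_ranking_induct[where f = f])
  case empty
  show ?case by simp
next
  case (insert x S)
  show ?case
  proof (cases "x \<in> S")
    case True
    then show ?thesis using insert.IH by (simp add: insert_absorb)
  next
    case False
    have "h (card {z \<in> insert x S. f z \<le> f y}) \<le> h (card {z \<in> S. f z \<le> f y})" if "y \<in> S" for y
    proof (rule h)
      have "{z \<in> S. f z \<le> f y} \<noteq> {}" using that by auto
      moreover have fin: "finite {z \<in> S. f z \<le> f y}" using insert.hyps by simp
      ultimately show "1 \<le> card {z \<in> S. f z \<le> f y}" by (simp add: card_gt_0_iff Suc_le_eq)
      show "card {z \<in> S. f z \<le> f y} \<le> card {z \<in> insert x S. f z \<le> f y}"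
        using insert.hyps by (intro card_mono) auto
    qed
    then have "(\<Sum>y\<in>S. h (card {z \<in> insert x S. f z \<le> f y})) \<le> (\<Sum>k=1..card S. h k)"
      using insert.IH by (meson order_trans sum_mono)
    moreover have "{z \<in> insert x S. f z \<le> f x} = insert x S" using insert.hyps by auto
    ultimately show ?thesis using False insert.hyps by simp
  qed
qed

text \<open>By the mean value theorem each term is at most an increment of
  \<open>x powr (1 - s) / (1 - s)\<close>, and the increments telescope. The first term is separate
  because the derivative is singular at 0.\<close>

lemma sum_powr_le:
  fixes s :: real
  assumes "0 < s" "s < 1"
  shows "(\<Sum>k=1..N. real k powr (-s)) \<le> real N powr (1 - s) / (1 - s)"
proof (induction N)
  case 0
  show ?case by simp
next
  case (Suc N)
  have "(1 - s) * real (Suc N) powr (-s) \<le> real (Suc N) powr (1 - s) - real N powr (1 - s)"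
  proof (cases "N = 0")
    case True
    then show ?thesis using assms by simp
  next
    case False
    have "((\<lambda>x. x powr (1 - s)) has_real_derivative (1 - s) * x powr (-s)) (at x)" if "real N \<le> x" for x
      using that False by (auto intro!: derivative_eq_intros)
    then obtain \<xi> where \<xi>: "real N < \<xi>" "\<xi> < real (Suc N)"
      "real (Suc N) powr (1 - s) - real N powr (1 - s) = (real (Suc N) - real N) * ((1 - s) * \<xi> powr (-s))"
      using MVT2[of "real N" "real (Suc N)" "\<lambda>x. x powr (1 - s)" "\<lambda>x. (1 - s) * x powr (-s)"] by auto
    have "real (Suc N) powr (-s) \<le> \<xi> powr (-s)" using \<xi> assms False by (intro powr_mono2') auto
    then show ?thesis using \<xi>(3) assms by simp
  qed
  then have "real (Suc N) powr (-s) \<le> (real (Suc N) powr (1 - s) - real N powr (1 - s)) / (1 - s)"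
    using assms by (simp add: pos_le_divide_eq mult.commute)
  then show ?case using Suc by (simp add: diff_divide_distrib)
qed

section \<open>The Assouad condition and the energy of separated sets\<close>

text \<open>The condition inside \<open>assouad_dim\<close> with the constant made explicit, so that
  one constant serves all subsets, in particular the separated sets at every scale.\<close>

definition assouad_bound :: "real \<Rightarrow> real \<Rightarrow> 'a::metric_space set \<Rightarrow> bool" where
  "assouad_bound \<alpha> C F \<longleftrightarrow> (\<forall>r R. \<forall>x\<in>F. 0 < r \<and> r < R \<longrightarrow>
     real (covering_number r (cball x R \<inter> F)) \<le> C * (R / r) powr \<alpha>)"

lemma assouad_bound_subset:
  fixes F :: "'a::euclidean_space set"
  assumes "assouad_bound \<alpha> C F" "E \<subseteq> F"
  shows "assouad_bound \<alpha> C E"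
  unfolding assouad_bound_def
proof (intro allI ballI impI)
  fix r R :: real and x assume x: "x \<in> E" and r: "0 < r \<and> r < R"
  have "covering_number r (cball x R \<inter> E) \<le> covering_number r (cball x R \<inter> F)"
    using assms(2) r by (intro covering_number_mono) auto
  moreover have "real (covering_number r (cball x R \<inter> F)) \<le> C * (R / r) powr \<alpha>"
    using assms x r unfolding assouad_bound_def by blast
  ultimately show "real (covering_number r (cball x R \<inter> E)) \<le> C * (R / r) powr \<alpha>" by linarith
qed

text \<open>Some exponent below \<open>\<alpha>\<close> is admissible, and raising the exponent
  preserves the bound because \<open>R / r > 1\<close>.\<close>

lemma assouad_boundI_dim_less:
  assumes "assouad_dim F < ereal \<alpha>"
  obtains C where "0 < C" "assouad_bound \<alpha> C F"
proof -
  obtain \<beta> C where \<beta>: "\<beta> < \<alpha>" "0 < C" "assouad_bound \<beta> C F"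
    using assms unfolding assouad_dim_def Inf_less_iff assouad_bound_def by auto
  have "assouad_bound \<alpha> C F"
    unfolding assouad_bound_def
  proof (intro allI ballI impI)
    fix r R :: real and x assume x: "x \<in> F" and r: "0 < r \<and> r < R"
    have "real (covering_number r (cball x R \<inter> F)) \<le> C * (R / r) powr \<beta>"
      using \<beta>(3) x r unfolding assouad_bound_def by blast
    also have "\<dots> \<le> C * (R / r) powr \<alpha>"
      using r \<beta>(1,2) by (intro mult_left_mono powr_mono) auto
    finally show "real (covering_number r (cball x R \<inter> F)) \<le> C * (R / r) powr \<alpha>" .
  qed
  then show ?thesis using that \<beta>(2) by blast
qed

text \<open>The energy of the uniform measure on a separated set: ranking the points by their distance
  from \<open>x\<close> turns the Assouad bound into \<open>p x y \<le> K * rank y powr (-s)\<close>.\<close>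

lemma separated_energy_le:
  fixes X :: "'a::euclidean_space set" and p :: "'a \<Rightarrow> 'a \<Rightarrow> real"
  assumes "assouad_bound \<alpha> C X" "0 < C" "1 \<le> m" "real m < \<alpha>" "0 \<le> c" "0 < r" "finite X"
    and sep: "\<And>x y. x \<in> X \<Longrightarrow> y \<in> X \<Longrightarrow> x \<noteq> y \<Longrightarrow> r / 2 < dist x y"
    and p1: "\<And>x y. p x y \<le> 1" and pd: "\<And>x y. x \<noteq> y \<Longrightarrow> p x y \<le> c * (r / dist x y) ^ m"
  defines "s \<equiv> real m / \<alpha>"
  shows "(\<Sum>x\<in>X. \<Sum>y\<in>X. p x y) \<le> (1 + c * 2 ^ m * C powr s) / (1 - s) * real (card X) powr (2 - s)"
proof -
  have s: "0 < s" "s < 1" using assms(3,4) by (auto simp: s_def)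
  \<comment> \<open>The summand 1 covers the diagonal \<open>y = x\<close>, where the rank is 1; the
    other summand is the constant for \<open>y \<noteq> x\<close>.\<close>
  define K where "K = 1 + c * 2 ^ m * C powr s"
  have K: "1 \<le> K" using assms(2,5) by (simp add: K_def)
  have row: "(\<Sum>y\<in>X. p x y) \<le> K * (real (card X) powr (1 - s) / (1 - s))" if x: "x \<in> X" for x
  proof -
    let ?rank = "\<lambda>y. card {z \<in> X. dist x z \<le> dist x y}"
    have "p x y \<le> K * real (?rank y) powr (-s)" if y: "y \<in> X" for y
    proof (cases "x = y")
      case True
      have "{z \<in> X. dist x z \<le> dist x y} = {x}" using True x by auto
      then show ?thesis using p1[of x y] K by simp
    next
      case False
      define d where "d = dist x y"
      have d: "r / 2 < d" using sep[OF x y False] by (simp add: d_def)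
      then have d0: "0 < d" using assms(6) by simp
      let ?k = "real (?rank y)"
      \<comment> \<open>The rank of \<open>y\<close> counts separated points in the ball of radius
        \<open>d\<close> about \<open>x\<close>, so the Assouad bound with radii
        \<open>r/2 < d\<close> limits it.\<close>
      have "{z \<in> X. dist x z \<le> d} = cball x d \<inter> X" by auto
      moreover have "card (cball x d \<inter> X) \<le> covering_number (r/2) (cball x d \<inter> X)"
        using sep assms(6) by (intro card_separated_le_covering_number) (auto intro: bounded_Int)
      moreover have "real (covering_number (r/2) (cball x d \<inter> X)) \<le> C * (d / (r/2)) powr \<alpha>"
        using assms(1,6) x d unfolding assouad_bound_def by (metis half_gt_zero)
      ultimately have "?k \<le> C * (2 * d / r) powr \<alpha>" by (simp add: d_def mult.commute)
      then have kC: "?k / C \<le> (2 * d / r) powr \<alpha>" using assms(2) by (simp add: pos_divide_le_eq mult.commute)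
      have "x \<in> {z \<in> X. dist x z \<le> dist x y}" using x by simp
      then have k1: "0 < ?k" using assms(7) by (auto simp: card_gt_0_iff)
      \<comment> \<open>The power \<open>s = m / \<alpha>\<close> turns the exponent
        \<open>\<alpha>\<close> of the Assouad bound into the exponent \<open>m\<close> of the slab
        estimate.\<close>
      have "(?k / C) powr s \<le> ((2 * d / r) powr \<alpha>) powr s"
        using kC k1 assms(2) s by (intro powr_mono2) auto
      also have "\<dots> = (2 * d / r) ^ m"
        using d0 assms(3,4,6) by (simp add: powr_powr s_def powr_realpow)
      finally have 1: "(?k / C) powr s \<le> (2 * d / r) ^ m" .
      have "(r / d) ^ m = 2 ^ m * inverse ((2 * d / r) ^ m)"
        using d0 assms(6) by (simp add: power_divide power_mult_distrib field_simps)
      also have "\<dots> \<le> 2 ^ m * inverse ((?k / C) powr s)"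
        using 1 k1 assms(2) by (intro mult_left_mono le_imp_inverse_le) auto
      also have "inverse ((?k / C) powr s) = C powr s * ?k powr (-s)"
        using k1 assms(2) by (simp add: powr_divide powr_minus field_simps)
      finally have "(r / d) ^ m \<le> 2 ^ m * (C powr s * ?k powr (-s))" .
      then have "c * (r / d) ^ m \<le> c * (2 ^ m * (C powr s * ?k powr (-s)))"
        using assms(5) by (rule mult_left_mono)
      then have "p x y \<le> (c * 2 ^ m * C powr s) * ?k powr (-s)"
        using pd[OF False] by (simp add: d_def mult.assoc)
      also have "\<dots> \<le> K * ?k powr (-s)" by (intro mult_right_mono) (auto simp: K_def)
      finally show ?thesis .
    qed
    then have "(\<Sum>y\<in>X. p x y) \<le> K * (\<Sum>y\<in>X. real (?rank y) powr (-s))"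
      by (simp add: sum_distrib_left sum_mono)
    also have "\<dots> \<le> K * (\<Sum>k=1..card X. real k powr (-s))"
    proof (rule mult_left_mono)
      show "(\<Sum>y\<in>X. real (?rank y) powr (-s)) \<le> (\<Sum>k=1..card X. real k powr (-s))"
        using assms(7) s by (intro sum_rank_le) (auto intro!: powr_mono2')
    qed (use K in simp)
    also have "\<dots> \<le> K * (real (card X) powr (1 - s) / (1 - s))"
      using K sum_powr_le[OF s] by (intro mult_left_mono) auto
    finally show ?thesis .
  qed
  have "(\<Sum>x\<in>X. \<Sum>y\<in>X. p x y) \<le> (\<Sum>x\<in>X. K * (real (card X) powr (1 - s) / (1 - s)))"
    using row by (rule sum_mono)
  also have "\<dots> = K / (1 - s) * (real (card X) * real (card X) powr (1 - s))" by simp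
  also have "real (card X) * real (card X) powr (1 - s) = real (card X) powr (2 - s)"
    by (cases "card X = 0") (simp_all add: powr_mult_base)
  finally show ?thesis by (simp add: K_def)
qed

section \<open>Counting close pairs and the Borel-Cantelli argument\<close>

text \<open>Markov's inequality for the number of pairs, a sum of indicators whose expectation is
  the sum of the pair probabilities.\<close>

lemma (in prob_space) measure_card_pairs_ge_le:
  assumes "finite X" "0 < t" and meas: "\<And>x y. {\<omega> \<in> space M. Q \<omega> x y} \<in> events"
  shows "prob {\<omega> \<in> space M. t \<le> real (card {(x, y) \<in> X \<times> X. Q \<omega> x y})}
      \<le> (\<Sum>x\<in>X. \<Sum>y\<in>X. prob {\<omega> \<in> space M. Q \<omega> x y}) / t"
    and "{\<omega> \<in> space M. t \<le> real (card {(x, y) \<in> X \<times> X. Q \<omega> x y})} \<in> events"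
proof -
  let ?Z = "\<lambda>\<omega>. \<Sum>(x, y)\<in>X \<times> X. indicator {\<omega> \<in> space M. Q \<omega> x y} \<omega> :: real"
  have Z: "real (card {(x, y) \<in> X \<times> X. Q \<omega> x y}) = ?Z \<omega>" if "\<omega> \<in> space M" for \<omega>
  proof -
    have "?Z \<omega> = (\<Sum>q\<in>X \<times> X. if Q \<omega> (fst q) (snd q) then 1 else 0)"
      using that by (intro sum.cong) (auto simp: indicator_def)
    also have "\<dots> = real (card {q \<in> X \<times> X. Q \<omega> (fst q) (snd q)})"
      using assms(1) by (subst sum.If_cases) (auto simp: Int_def)
    also have "{q \<in> X \<times> X. Q \<omega> (fst q) (snd q)} = {(x, y) \<in> X \<times> X. Q \<omega> x y}" by auto
    finally show ?thesis by simp
  qed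
  have int: "integrable M ?Z"
    using meas by (auto intro!: Bochner_Integration.integrable_sum integrable_real_indicator simp: less_top[symmetric])
  have eq: "{\<omega> \<in> space M. t \<le> real (card {(x, y) \<in> X \<times> X. Q \<omega> x y})} = {\<omega> \<in> space M. t \<le> ?Z \<omega>}"
    using Z by auto
  have "prob {\<omega> \<in> space M. t \<le> ?Z \<omega>} \<le> (\<integral>\<omega>. ?Z \<omega> \<partial>M) / t"
    using int assms(2) by (intro integral_Markov_inequality_measure[where A = "{}"]) (auto intro!: sum_nonneg)
  also have "(\<integral>\<omega>. ?Z \<omega> \<partial>M) = (\<Sum>(x, y)\<in>X \<times> X. prob {\<omega> \<in> space M. Q \<omega> x y})"
    using meas by (subst Bochner_Integration.integral_sum)
      (auto intro!: sum.cong integrable_real_indicator simp: less_top[symmetric] Int_absorb2)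
  also have "\<dots> = (\<Sum>x\<in>X. \<Sum>y\<in>X. prob {\<omega> \<in> space M. Q \<omega> x y})" by (simp add: sum.cartesian_product)
  finally show "prob {\<omega> \<in> space M. t \<le> real (card {(x, y) \<in> X \<times> X. Q \<omega> x y})}
      \<le> (\<Sum>x\<in>X. \<Sum>y\<in>X. prob {\<omega> \<in> space M. Q \<omega> x y}) / t" unfolding eq .
  have "?Z \<in> borel_measurable M" using int by auto
  then show "{\<omega> \<in> space M. t \<le> real (card {(x, y) \<in> X \<times> X. Q \<omega> x y})} \<in> events" unfolding eq by measurable
qed

text \<open>With \<open>N\<close> separated points at scale \<open>(1/2)^k\<close>, almost surely
  there are fewer than \<open>2 powr (\<epsilon> * k) * N powr (2 - \<sigma>)\<close> close pairs
  for all large \<open>k\<close>. By Cauchy-Schwarz the projection then has covering number at least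
  \<open>N powr \<sigma> * 2 powr (- \<epsilon> * k)\<close>; logarithms give the claim.\<close>

lemma AE_dyadic_ratio_projection_ge:
  fixes E :: "(real^'n) set"
  assumes \<gamma>: "invariant_grassmann_measure m \<gamma>" and E: "bounded E" "E \<noteq> {}"
    and A: "assouad_bound \<alpha> C E" "0 < C" "1 \<le> m" "real m < \<alpha>" and "0 < \<epsilon>"
  shows "AE V in \<gamma>. \<forall>\<^sub>F k in sequentially.
    real m / \<alpha> * dyadic_ratio E k - \<epsilon> \<le> dyadic_ratio (orth_proj V ` E) k"
proof -
  have s: "sets \<gamma> = sets (grassmann_borel m)" using \<gamma> by (simp add: invariant_grassmann_measure_def)
  have sp: "space \<gamma> = grassmannian m"
    using sets_eq_imp_space_eq[OF s] by (simp add: grassmann_borel_def)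
  interpret prob_space \<gamma> using \<gamma> by (simp add: invariant_grassmann_measure_def)
  obtain c where c: "0 < c" "\<And>x \<rho>. x \<noteq> 0 \<Longrightarrow> 0 \<le> \<rho> \<Longrightarrow>
      measure \<gamma> {V \<in> space \<gamma>. norm (orth_proj V x) \<le> \<rho>} \<le> c * (\<rho> / norm x) ^ m"
    using grassmann_slab_le[OF \<gamma>] by blast
  define \<sigma> where "\<sigma> = real m / \<alpha>"
  have \<sigma>: "0 < \<sigma>" "\<sigma> < 1" using A(3,4) by (auto simp: \<sigma>_def)
  define r :: "nat \<Rightarrow> real" where "r k = (1/2) ^ k" for k
  have r: "0 < r k" for k by (simp add: r_def)
  have "\<exists>X. X \<subseteq> E \<and> finite X \<and> covering_number (r k) E \<le> card X \<and>
    (\<forall>x\<in>X. \<forall>y\<in>X. x \<noteq> y \<longrightarrow> r k / 2 < dist x y)" for k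
    using exists_separated_set[OF E(1) r[of k]] by metis
  then obtain X where X: "\<And>k. X k \<subseteq> E" "\<And>k. finite (X k)" "\<And>k. covering_number (r k) E \<le> card (X k)"
    "\<And>k x y. x \<in> X k \<Longrightarrow> y \<in> X k \<Longrightarrow> x \<noteq> y \<Longrightarrow> r k / 2 < dist x y"
    by metis
  define N where "N k = real (card (X k))" for k
  have N1: "1 \<le> real (covering_number (r k) E)" "real (covering_number (r k) E) \<le> N k" "1 \<le> N k" for k
    using covering_number_pos[OF E(1) r E(2), of k] X(3)[of k] by (auto simp: N_def)
  define Q where "Q k V x y \<longleftrightarrow> dist (orth_proj V x) (orth_proj V y) \<le> r k" for k V and x y :: "real^'n"
  \<comment> \<open>By linearity two projections are close exactly when the difference
    \<open>x - y\<close> has a short projection, which is a slab event.\<close>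
  have Qeq: "{V \<in> space \<gamma>. Q k V x y} = {V \<in> space \<gamma>. norm (orth_proj V (x - y)) \<le> r k}" for k x y
  proof -
    have "orth_proj V (x - y) = orth_proj V x - orth_proj V y" if "V \<in> space \<gamma>" for V
    proof -
      have "linear (orth_proj V)" using that by (intro linear_orth_proj) (simp add: sp grassmannian_def)
      then show ?thesis by (rule linear_diff)
    qed
    then show ?thesis by (auto simp: Q_def dist_norm)
  qed
  have Qm: "{V \<in> space \<gamma>. Q k V x y} \<in> events" for k x y
    using norm_orth_proj_measurable_grassmann[OF s, of "x - y", measurable] unfolding Qeq by measurable
  \<comment> \<open>The threshold exceeds the bound on the expected number of close pairs by
    \<open>2 powr (\<epsilon> * k)\<close>, up to the constant \<open>D\<close>, which makes the
    exceptional probabilities summable.\<close>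
  define t where "t k = 2 powr (\<epsilon> * real k) * N k powr (2 - \<sigma>)" for k
  have N0: "0 < N k" for k using N1(3)[of k] by linarith
  have t: "0 < t k" for k unfolding t_def using N0[of k] by simp
  let ?A = "\<lambda>k. {V \<in> space \<gamma>. t k \<le> real (card {(x, y) \<in> X k \<times> X k. Q k V x y})}"
  define D where "D = (1 + c * 2 ^ m * C powr \<sigma>) / (1 - \<sigma>)"
  have prob: "prob (?A k) \<le> D * (2 powr (- \<epsilon>)) ^ k" for k
  proof -
    have "prob (?A k) \<le> (\<Sum>x\<in>X k. \<Sum>y\<in>X k. prob {V \<in> space \<gamma>. Q k V x y}) / t k"
      using X(2) t Qm by (rule measure_card_pairs_ge_le(1))
    also have "(\<Sum>x\<in>X k. \<Sum>y\<in>X k. prob {V \<in> space \<gamma>. Q k V x y}) \<le> D * N k powr (2 - \<sigma>)"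
      unfolding D_def N_def \<sigma>_def
    proof (rule separated_energy_le)
      show "assouad_bound \<alpha> C (X k)" using A(1) X(1) by (rule assouad_bound_subset)
      show "prob {V \<in> space \<gamma>. Q k V x y} \<le> c * (r k / dist x y) ^ m" if "x \<noteq> y" for x y
        unfolding Qeq dist_norm using that c(2)[of "x - y" "r k"] r[of k] by simp
    qed (use A c(1) r X in auto)
    finally have "prob (?A k) \<le> D * N k powr (2 - \<sigma>) / t k"
      using t[of k] by (simp add: divide_right_mono)
    also have "\<dots> = D * 2 powr (- (\<epsilon> * real k))"
      using N0[of k] by (simp add: t_def powr_minus field_simps)
    also have "2 powr (- (\<epsilon> * real k)) = (2 powr (- \<epsilon>)) ^ k"
      by (simp add: powr_realpow[symmetric] powr_powr)
    finally show ?thesis .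
  qed
  have "2 powr (- \<epsilon>) < 1" using powr_less_mono[of "- \<epsilon>" 0 2] \<open>0 < \<epsilon>\<close> by simp
  then have "summable (\<lambda>k. D * (2 powr (- \<epsilon>)) ^ k)"
    by (intro summable_mult summable_geometric) simp
  then have "summable (\<lambda>k. prob (?A k))"
    by (rule summable_comparison_test'[of _ 0]) (use prob in simp)
  then have "AE V in \<gamma>. \<forall>\<^sub>F k in sequentially. V \<in> space \<gamma> - ?A k"
    using measure_card_pairs_ge_le(2)[OF X(2) t Qm]
    by (intro borel_cantelli_AE1) (simp_all add: less_top[symmetric])
  then show ?thesis
  proof eventually_elim
    case (elim V)
    have "\<forall>\<^sub>F k in sequentially. 1 \<le> k" by (rule eventually_ge_at_top)
    with elim show ?case
    proof eventually_elim
      case (elim k)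
      have V: "subspace V" using elim(1) by (simp add: sp grassmannian_def)
      have "bounded_linear (orth_proj V)"
        using linear_orth_proj[OF V] by (simp add: linear_conv_bounded_linear)
      then have b: "bounded (orth_proj V ` E)" using E(1) by (rule bounded_linear_image[rotated])
      define M where "M = real (covering_number (r k) (orth_proj V ` E))"
      have M: "1 \<le> M" using covering_number_pos[OF b r[of k]] E(2) by (simp add: M_def)
      have "(card (X k))\<^sup>2 \<le> covering_number (r k) (orth_proj V ` E) * card {(x, y) \<in> X k \<times> X k. Q k V x y}"
        unfolding Q_def using b r X(1,2) by (rule card_squared_le_covering_number_image)
      then have "real ((card (X k))\<^sup>2) \<le>
          real (covering_number (r k) (orth_proj V ` E) * card {(x, y) \<in> X k \<times> X k. Q k V x y})"
        by (rule of_nat_mono)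
      then have "(N k)\<^sup>2 \<le> M * real (card {(x, y) \<in> X k \<times> X k. Q k V x y})"
        by (simp add: N_def M_def)
      also have "\<dots> \<le> M * t k" using elim(1) M by (intro mult_left_mono) auto
      finally have "ln ((N k)\<^sup>2) \<le> ln (M * t k)"
        using N0[of k] M t[of k] by (subst ln_le_cancel_iff) auto
      also have "ln (M * t k) = ln M + (\<epsilon> * real k * ln 2 + (2 - \<sigma>) * ln (N k))"
        unfolding t_def using M N0[of k] by (simp add: ln_mult ln_powr)
      also have "ln ((N k)\<^sup>2) = 2 * ln (N k)" using N0[of k] by (simp add: ln_realpow)
      finally have "\<sigma> * ln (N k) - \<epsilon> * (real k * ln 2) \<le> ln M" by (simp add: algebra_simps)
      moreover have "ln (real (covering_number (r k) E)) \<le> ln (N k)"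
        using N1[of k] by simp
      then have "\<sigma> * ln (real (covering_number (r k) E)) \<le> \<sigma> * ln (N k)"
        using \<sigma> by (intro mult_left_mono) auto
      ultimately have "\<sigma> * ln (real (covering_number (r k) E)) - \<epsilon> * (real k * ln 2) \<le> ln M" by linarith
      moreover have kl: "0 < real k * ln 2" using elim(2) by simp
      ultimately have "(\<sigma> * ln (real (covering_number (r k) E)) - \<epsilon> * (real k * ln 2)) / (real k * ln 2) \<le> ln M / (real k * ln 2)"
        by (intro divide_right_mono) auto
      moreover have "(\<sigma> * ln (real (covering_number (r k) E)) - \<epsilon> * (real k * ln 2)) / (real k * ln 2) =
          \<sigma> * (ln (real (covering_number (r k) E)) / (real k * ln 2)) - \<epsilon>"
        using kl elim(2) by (simp add: diff_divide_distrib)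
      ultimately show ?case unfolding \<sigma>_def M_def r_def by simp
    qed
  qed
qed

text \<open>The Assouad bound is taken at exponents \<open>\<alpha> j\<close> decreasing to
  \<open>a\<close>, since the infimum need not be attained. Countably many exponents and errors
  leave one common null set, off which \<open>j\<close> tends to infinity. The Assouad dimension is
  that of a superset \<open>F\<close> so that the result applies to pieces of
  \<open>F\<close>.\<close>

lemma AE_box_dim_projection_ge:
  fixes E F :: "(real^'n) set"
  assumes \<gamma>: "invariant_grassmann_measure m \<gamma>" and m: "1 \<le> m" and E: "bounded E" "E \<noteq> {}" "E \<subseteq> F"
    and a: "assouad_dim F = ereal a" "real m \<le> a"
  shows "AE V in \<gamma>. \<forall>d\<ge>0.
    (ereal d \<le> upper_box_dim E \<longrightarrow> ereal (real m / a * d) \<le> upper_box_dim (orth_proj V ` E)) \<and>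
    (ereal d \<le> lower_box_dim E \<longrightarrow> ereal (real m / a * d) \<le> lower_box_dim (orth_proj V ` E))"
proof -
  have s: "sets \<gamma> = sets (grassmann_borel m)" using \<gamma> by (simp add: invariant_grassmann_measure_def)
  have sp: "space \<gamma> = grassmannian m"
    using sets_eq_imp_space_eq[OF s] by (simp add: grassmann_borel_def)
  define \<alpha> where "\<alpha> j = a + 1 / real (Suc j)" for j
  have \<alpha>: "real m < \<alpha> j" "a < \<alpha> j" "0 < \<alpha> j" for j
  proof -
    have "0 < 1 / real (Suc j)" by simp
    then show "real m < \<alpha> j" "a < \<alpha> j" "0 < \<alpha> j" using a(2) m unfolding \<alpha>_def by linarith+
  qed
  have "AE V in \<gamma>. \<forall>\<^sub>F k in sequentially.
      real m / \<alpha> j * dyadic_ratio E k - 1 / real (Suc i) \<le> dyadic_ratio (orth_proj V ` E) k" for i j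
  proof -
    obtain C where C: "0 < C" "assouad_bound (\<alpha> j) C F"
      using assouad_boundI_dim_less[of F "\<alpha> j"] a(1) \<alpha> by auto
    show ?thesis
      using assouad_bound_subset[OF C(2) E(3)] C(1) m \<alpha>(1)
      by (intro AE_dyadic_ratio_projection_ge[OF \<gamma> E(1,2)]) auto
  qed
  then have "AE V in \<gamma>. \<forall>i j. \<forall>\<^sub>F k in sequentially.
      real m / \<alpha> j * dyadic_ratio E k - 1 / real (Suc i) \<le> dyadic_ratio (orth_proj V ` E) k"
    by (simp add: AE_all_countable)
  then show ?thesis using AE_space
  proof eventually_elim
    case (elim V)
    have "subspace V" using elim(2) by (simp add: sp grassmannian_def)
    then have "bounded_linear (orth_proj V)"
      using linear_orth_proj by (simp add: linear_conv_bounded_linear)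
    then have b: "bounded (orth_proj V ` E)" using E(1) by (rule bounded_linear_image[rotated])
    have ne: "orth_proj V ` E \<noteq> {}" using E(2) by simp
    have ev: "\<forall>\<^sub>F k in sequentially. real m / \<alpha> j * dyadic_ratio E k - \<epsilon> \<le> dyadic_ratio (orth_proj V ` E) k"
      if \<epsilon>: "0 < \<epsilon>" for j \<epsilon>
    proof -
      obtain i where i: "1 / real (Suc i) < \<epsilon>" using nat_approx_posE[OF \<epsilon>] by blast
      have "\<forall>\<^sub>F k in sequentially.
        real m / \<alpha> j * dyadic_ratio E k - 1 / real (Suc i) \<le> dyadic_ratio (orth_proj V ` E) k"
        using elim(1) by blast
      then show ?thesis by eventually_elim (use i in linarith)
    qed
    have ms: "0 < real m / \<alpha> j" for j using m \<alpha>(3)[of j] by simp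
    note tr = box_dim_transfer[OF E(1,2) b ne ms ev]
    have "\<alpha> \<longlonglongrightarrow> a + 0" unfolding \<alpha>_def
      by (intro tendsto_add tendsto_const LIMSEQ_Suc[OF lim_1_over_n])
    then have lim: "(\<lambda>j. ereal (real m / \<alpha> j * d)) \<longlonglongrightarrow> ereal (real m / a * d)" for d
      using a(2) m by (intro tendsto_ereal tendsto_mult tendsto_divide tendsto_const) auto
    show ?case
    proof (intro allI impI conjI)
      fix d :: real assume d: "0 \<le> d"
      have step: "ereal (real m / \<alpha> j * d) \<le> ereal (real m / \<alpha> j) * x" if "ereal d \<le> x" for j x
        using ereal_mult_left_mono[OF that, of "ereal (real m / \<alpha> j)"] ms[of j] by simp
      show "ereal (real m / a * d) \<le> upper_box_dim (orth_proj V ` E)" if "ereal d \<le> upper_box_dim E"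
        using lim by (rule LIMSEQ_le_const2) (use step[OF that] tr(1) order_trans in blast)
      show "ereal (real m / a * d) \<le> lower_box_dim (orth_proj V ` E)" if "ereal d \<le> lower_box_dim E"
        using lim by (rule LIMSEQ_le_const2) (use step[OF that] tr(2) order_trans in blast)
    qed
  qed
qed

subsection \<open>Packing dimension and Baire category\<close>

text \<open>Over a Polish space these are the analytic sets; the Polish space of real sequences
  takes the place of the Baire space.\<close>

definition closed_projection :: "'a::topological_space set \<Rightarrow> bool" where
  "closed_projection F \<longleftrightarrow> (\<exists>G :: ('a \<times> (nat \<Rightarrow> real)) set. closed G \<and> F = fst ` G)"

lemma closed_projection_closed: "closed F \<Longrightarrow> closed_projection F"
  unfolding closed_projection_def by (intro exI[of _ "F \<times> UNIV"]) (auto simp: closed_Times)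

lemma continuous_on_coord_snd:
  "continuous_on UNIV (\<lambda>p :: 'a::topological_space \<times> (nat \<Rightarrow> real). snd p n)"
  by (rule continuous_on_compose2[OF continuous_on_product_coordinates continuous_on_snd[OF continuous_on_id]]) simp

lemma continuous_on_reindex_snd:
  "continuous_on UNIV (\<lambda>(x :: 'a::topological_space, z :: nat \<Rightarrow> real). (x, \<lambda>n. z (f n)))"
proof -
  have "continuous_on UNIV (\<lambda>p :: 'a \<times> (nat \<Rightarrow> real). \<lambda>n. snd p (f n))"
    by (intro continuous_on_coordinatewise_then_product continuous_on_coord_snd)
  then show ?thesis
    unfolding case_prod_beta using continuous_on_fst[OF continuous_on_id] by (rule continuous_on_Pair[rotated])
qed

lemma closed_projection_UN:
  assumes "\<And>i :: nat. closed_projection (F i)"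
  shows "closed_projection (\<Union>i. F i)"
proof -
  obtain G :: "nat \<Rightarrow> ('a \<times> (nat \<Rightarrow> real)) set" where G: "\<And>i. closed (G i)" "\<And>i. F i = fst ` G i"
    using assms unfolding closed_projection_def by metis
  let ?s = "\<lambda>(x :: 'a, z :: nat \<Rightarrow> real). (x, \<lambda>n. z (Suc n))"
  let ?c = "\<lambda>p :: 'a \<times> (nat \<Rightarrow> real). snd p 0"
  \<comment> \<open>The coordinate \<open>z 0 \<in> \<nat>\<close> selects the member of the union; writing \<open>z 0 \<noteq> i\<close> as \<open>1 \<le> \<bar>z 0 - i\<bar>\<close> keeps the set closed.\<close>
  define H where "H = ?c -` \<nat> \<inter> (\<Inter>i. {p. 1 \<le> \<bar>?c p - real i\<bar>} \<union> ?s -` G i)"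
  note c = continuous_on_coord_snd[of 0]
  have "closed H"
    unfolding H_def
  proof (intro closed_Int closed_INT ballI closed_Un)
    show "closed (?c -` \<nat>)" using closed_Nats c by (rule closed_vimage)
    show "closed {p. 1 \<le> \<bar>?c p - real i\<bar>}" for i
      using c by (intro closed_Collect_le continuous_on_const continuous_on_rabs continuous_on_diff)
    show "closed (?s -` G i)" for i
      using G(1) continuous_on_reindex_snd by (rule closed_vimage)
  qed
  moreover have "(\<Union>i. F i) = fst ` H"
  proof
    show "(\<Union>i. F i) \<subseteq> fst ` H"
    proof
      fix x assume "x \<in> (\<Union>i. F i)"
      then obtain i z where z: "(x, z) \<in> G i" using G(2) by force
      let ?z = "case_nat (real i) z"
      have "1 \<le> \<bar>real i - real j\<bar> \<or> (x, z) \<in> G j" for j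
        using z by (cases "i = j") (auto simp: abs_if)
      then have "(x, ?z) \<in> H" by (simp add: H_def)
      then show "x \<in> fst ` H" by force
    qed
    show "fst ` H \<subseteq> (\<Union>i. F i)"
    proof
      fix x assume "x \<in> fst ` H"
      then obtain z where z: "(x, z) \<in> H" by force
      then obtain i where "z 0 = real i" by (auto simp: H_def elim: Nats_cases)
      moreover have "1 \<le> \<bar>z 0 - real i\<bar> \<or> (x, \<lambda>n. z (Suc n)) \<in> G i" using z by (simp add: H_def)
      ultimately have "(x, \<lambda>n. z (Suc n)) \<in> G i" by simp
      then show "x \<in> (\<Union>i. F i)" using G(2) by force
    qed
  qed
  ultimately show ?thesis unfolding closed_projection_def by blast
qed

text \<open>A point of the intersection needs one witness sequence for each \<open>i\<close>; the
  pairing function packs all of them into a single sequence.\<close>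

lemma closed_projection_INT:
  assumes "\<And>i :: nat. closed_projection (F i)"
  shows "closed_projection (\<Inter>i. F i)"
proof -
  obtain G :: "nat \<Rightarrow> ('a \<times> (nat \<Rightarrow> real)) set" where G: "\<And>i. closed (G i)" "\<And>i. F i = fst ` G i"
    using assms unfolding closed_projection_def by metis
  let ?s = "\<lambda>i (x :: 'a, z :: nat \<Rightarrow> real). (x, \<lambda>n. z (prod_encode (i, n)))"
  define H where "H = (\<Inter>i. ?s i -` G i)"
  have "closed H"
    unfolding H_def using continuous_on_reindex_snd G(1) by (intro closed_INT ballI closed_vimage) auto
  moreover have "(\<Inter>i. F i) = fst ` H"
  proof
    show "(\<Inter>i. F i) \<subseteq> fst ` H"
    proof
      fix x assume "x \<in> (\<Inter>i. F i)"
      then have "\<exists>z. (x, z) \<in> G i" for i using G(2)[of i] by force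
      then obtain z where z: "\<And>i. (x, z i) \<in> G i" by metis
      let ?z = "\<lambda>n. z (fst (prod_decode n)) (snd (prod_decode n))"
      have "(x, ?z) \<in> H" using z by (simp add: H_def)
      then show "x \<in> fst ` H" by force
    qed
    show "fst ` H \<subseteq> (\<Inter>i. F i)" using G(2) by (force simp: H_def)
  qed
  ultimately show ?thesis unfolding closed_projection_def by blast
qed

text \<open>An open set is the union of the closed sets of points at distance at least
  \<open>1 / (n+1)\<close> from its complement.\<close>

lemma closed_projection_open:
  fixes U :: "'a::metric_space set"
  assumes "open U"
  shows "closed_projection U"
\<comment> \<open>The distance to an empty complement is 0 by convention, so this case is
  separate.\<close>
proof (cases "U = UNIV")
  case True
  then show ?thesis using closed_projection_closed[of U] by simp
next
  case False
  have "closed_projection {x. 1 / real (Suc n) \<le> infdist x (- U)}" for n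
    by (intro closed_projection_closed closed_Collect_le continuous_intros)
  then have "closed_projection (\<Union>n. {x. 1 / real (Suc n) \<le> infdist x (- U)})"
    by (rule closed_projection_UN)
  also have "(\<Union>n. {x. 1 / real (Suc n) \<le> infdist x (- U)}) = U"
  proof -
    have "(\<exists>n. 1 / real (Suc n) \<le> infdist x (- U)) \<longleftrightarrow> 0 < infdist x (- U)" for x
    proof
      assume "\<exists>n. 1 / real (Suc n) \<le> infdist x (- U)"
      then obtain n where "1 / real (Suc n) \<le> infdist x (- U)" ..
      moreover have "0 < 1 / real (Suc n)" by simp
      ultimately show "0 < infdist x (- U)" by linarith
    next
      assume "0 < infdist x (- U)"
      then show "\<exists>n. 1 / real (Suc n) \<le> infdist x (- U)"
        using nat_approx_posE less_imp_le by metis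
    qed
    moreover have "0 < infdist x (- U) \<longleftrightarrow> x \<in> U" for x
      using in_closed_iff_infdist_zero[of "- U" x] assms False infdist_nonneg[of x "- U"]
      by (auto simp: closed_Compl order_less_le)
    ultimately show ?thesis by auto
  qed
  finally show ?thesis .
qed

text \<open>Projections of closed sets are not stable under complements in general, so the induction
  carries the claim for a set and its complement together; countable unions and intersections then
  suffice.\<close>

lemma closed_projection_borel:
  fixes F :: "'a::metric_space set"
  assumes "F \<in> sets borel"
  shows "closed_projection F"
proof -
  have "F \<in> sigma_sets UNIV {S. open S}" using assms by (simp add: borel_def)
  then have "closed_projection F \<and> closed_projection (- F)"
  proof (induction rule: sigma_sets.induct)
    case (Basic U)
    then show ?case by (simp add: closed_projection_open closed_projection_closed closed_Compl)
  next
    case Empty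
    then show ?case by (simp add: closed_projection_closed)
  next
    case (Compl U)
    then show ?case by (simp add: Compl_eq_Diff_UNIV[symmetric])
  next
    case (Union U)
    then show ?case
      using closed_projection_UN[of U] closed_projection_INT[of "\<lambda>i. - U i"] by (simp add: Compl_UN)
  qed
  then show ?thesis by blast
qed

text \<open>A closed subset of a complete space is itself completely metrizable, so one of the
  relatively closed sets \<open>G \<inter> T j\<close> has nonempty relative interior.\<close>

lemma Baire_closed_cover:
  fixes G :: "'a::complete_space set" and T :: "nat \<Rightarrow> 'a set"
  assumes "closed G" "G \<noteq> {}" "\<And>j. closed (T j)" "G \<subseteq> (\<Union>j. T j)"
  obtains j W where "open W" "W \<inter> G \<noteq> {}" "W \<inter> G \<subseteq> T j"
proof -
  let ?X = "top_of_set G"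
  have "completely_metrizable_space ?X"
    using assms(1) closed_closedin completely_metrizable_space_closedin completely_metrizable_space_euclidean by blast
  have "\<exists>j. ?X interior_of (G \<inter> T j) \<noteq> {}"
  proof (rule ccontr)
    assume "\<not> ?thesis"
    moreover have "closedin ?X (G \<inter> T j)" for j using assms(3) by (rule closedin_closed_Int)
    ultimately have "?X interior_of \<Union>(range (\<lambda>j. G \<inter> T j)) = {}"
      using \<open>completely_metrizable_space ?X\<close> by (intro Baire_category_alt) auto
    moreover have "\<Union>(range (\<lambda>j. G \<inter> T j)) = G" using assms(4) by auto
    ultimately show False using assms(2) interior_of_topspace[of ?X] by simp
  qed
  then obtain j where j: "?X interior_of (G \<inter> T j) \<noteq> {}" ..
  have "openin ?X (?X interior_of (G \<inter> T j))" by (rule openin_interior_of)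
  then obtain W where W: "open W" "?X interior_of (G \<inter> T j) = G \<inter> W"
    unfolding openin_open by blast
  have "?X interior_of (G \<inter> T j) \<subseteq> G \<inter> T j" by (rule interior_of_subset)
  then show ?thesis using that[of W j] W j by auto
qed

section \<open>Countable covers by compact sets of small box dimension\<close>

text \<open>A strong form of \<open>packing_dim E \<le> t\<close> in which one cover already meets
  the bound \<open>t\<close>; this makes stability under countable unions immediate.\<close>

definition packing_covered :: "ereal \<Rightarrow> 'a::metric_space set \<Rightarrow> bool" where
  "packing_covered t E \<longleftrightarrow> (\<exists>K :: nat \<Rightarrow> 'a set.
     (\<forall>j. compact (K j) \<and> K j \<noteq> {} \<and> upper_box_dim (K j) \<le> t) \<and> E \<subseteq> (\<Union>j. K j))"

lemma packing_covered_mono: "packing_covered t E' \<Longrightarrow> E \<subseteq> E' \<Longrightarrow> packing_covered t E"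
  unfolding packing_covered_def using subset_trans by metis

lemma packing_dim_le_if_covered:
  fixes E :: "'a::metric_space set"
  assumes "packing_covered t E"
  shows "packing_dim E \<le> t"
proof -
  obtain K :: "nat \<Rightarrow> 'a set" where K: "(\<forall>j. compact (K j) \<and> K j \<noteq> {} \<and> upper_box_dim (K j) \<le> t) \<and> E \<subseteq> (\<Union>j. K j)"
    using assms unfolding packing_covered_def ..
  have "packing_dim E \<le> (SUP j. upper_box_dim (K j))"
    unfolding packing_dim_def using K by (intro Inf_lower CollectI exI[of _ K]) simp
  also have "\<dots> \<le> t" using K by (intro SUP_least) auto
  finally show ?thesis .
qed

lemma packing_covered_UN:
  assumes "countable \<A>" "\<A> \<noteq> {}" "\<And>E. E \<in> \<A> \<Longrightarrow> packing_covered t E"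
  shows "packing_covered t (\<Union>\<A>)"
proof -
  have "\<forall>i. packing_covered t (from_nat_into \<A> i)"
    using assms(3) from_nat_into[OF assms(2)] by simp
  then have "\<forall>i. \<exists>K. (\<forall>j. compact (K j) \<and> K j \<noteq> {} \<and> upper_box_dim (K j) \<le> t) \<and>
      from_nat_into \<A> i \<subseteq> (\<Union>j :: nat. K j)"
    unfolding packing_covered_def .
  from choice[OF this] obtain K :: "nat \<Rightarrow> nat \<Rightarrow> 'a set" where
    K': "\<forall>i. (\<forall>j. compact (K i j) \<and> K i j \<noteq> {} \<and> upper_box_dim (K i j) \<le> t) \<and>
      from_nat_into \<A> i \<subseteq> (\<Union>j. K i j)" ..
  then have K: "\<And>i j. compact (K i j) \<and> K i j \<noteq> {} \<and> upper_box_dim (K i j) \<le> t"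
    "\<And>i. from_nat_into \<A> i \<subseteq> (\<Union>j. K i j)"
    by simp_all
  let ?K = "\<lambda>n. K (fst (prod_decode n)) (snd (prod_decode n))"
  have "\<Union>\<A> \<subseteq> (\<Union>n. ?K n)"
  proof
    fix x assume "x \<in> \<Union>\<A>"
    then obtain E where "E \<in> \<A>" "x \<in> E" by blast
    then obtain i where "x \<in> from_nat_into \<A> i" using from_nat_into_surj[OF assms(1)] by metis
    then obtain j where "x \<in> K i j" using K(2) by blast
    then have "x \<in> ?K (prod_encode (i, j))" by simp
    then show "x \<in> (\<Union>n. ?K n)" by blast
  qed
  then show ?thesis unfolding packing_covered_def using K(1) by (intro exI[of _ ?K]) auto
qed

lemma packing_covered_if_upper_box_dim_le:
  fixes E :: "'a::euclidean_space set"
  assumes "bounded E" "E \<noteq> {}" "upper_box_dim E \<le> t"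
  shows "packing_covered t E"
proof -
  have "upper_box_dim (closure E) \<le> t" using upper_box_dim_closure_le[OF assms(1,2)] assms(3) by simp
  then show ?thesis
    unfolding packing_covered_def using assms(1,2) closure_subset[of E]
    by (intro exI[of _ "\<lambda>_. closure E"]) (auto simp: compact_closure)
qed

text \<open>Deleting from \<open>G\<close> the basic open pieces with small projection leaves a closed set all of whose
  relatively open pieces have a large projection.\<close>

lemma exists_packing_kernel:
  fixes F :: "'a::euclidean_space set"
  assumes F: "F \<in> sets borel" "F \<noteq> {}" and t: "t < packing_dim F"
  obtains H :: "('a \<times> (nat \<Rightarrow> real)) set" and \<B> where
    "closed H" "H \<noteq> {}" "fst ` H \<subseteq> F" "countable \<B>"
    "\<And>U. U \<in> \<B> \<Longrightarrow> bounded (fst ` (H \<inter> U)) \<and> H \<inter> U \<noteq> {} \<and> t < upper_box_dim (fst ` (H \<inter> U))"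
    "\<And>W. open W \<Longrightarrow> W \<inter> H \<noteq> {} \<Longrightarrow> \<exists>U\<in>\<B>. U \<subseteq> W"
proof -
  obtain G :: "('a \<times> (nat \<Rightarrow> real)) set" where G: "closed G" "F = fst ` G"
    using closed_projection_borel[OF F(1)] unfolding closed_projection_def by blast
  obtain \<B>0 :: "('a \<times> (nat \<Rightarrow> real)) set set" where \<B>0: "countable \<B>0" "topological_basis \<B>0"
    using ex_countable_basis by blast
  define S where "S = {U \<in> \<B>0. packing_covered t (fst ` (G \<inter> U))}"
  have cS: "countable S" using \<B>0(1) by (simp add: S_def)
  define H where "H = G - \<Union>S"
  have "open (\<Union>S)" using topological_basis_open[OF \<B>0(2)] by (auto simp: S_def)
  then have "closed H" unfolding H_def using G(1) by (simp add: closed_Diff)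
  have notcov: "\<not> packing_covered t F" using packing_dim_le_if_covered t by (auto simp: not_le[symmetric])
  \<comment> \<open>The part of \<open>G\<close> in \<open>U\<close> exceeds that of
    \<open>H\<close> only by points in members of \<open>S\<close>, which are countably many and
    have covered projections.\<close>
  have absorb: "packing_covered t (fst ` (G \<inter> U))" if "packing_covered t (fst ` (H \<inter> U))" for U
  proof -
    let ?A = "insert (fst ` (H \<inter> U)) ((\<lambda>W. fst ` (G \<inter> W)) ` S)"
    have "packing_covered t (\<Union>?A)"
      using that cS by (intro packing_covered_UN) (auto simp: S_def)
    moreover have "fst ` (G \<inter> U) \<subseteq> \<Union>?A"
    proof
      fix x assume "x \<in> fst ` (G \<inter> U)"
      then obtain p where p: "p \<in> G" "p \<in> U" "x = fst p" by auto
      show "x \<in> \<Union>?A"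
      proof (cases "p \<in> \<Union>S")
        case True
        then obtain W where "W \<in> S" "p \<in> W" by blast
        then show ?thesis using p by auto
      next
        case False
        then show ?thesis using p by (auto simp: H_def)
      qed
    qed
    ultimately show ?thesis by (rule packing_covered_mono)
  qed
  \<comment> \<open>If nothing were left, \<open>F\<close> would be a countable union of covered
    pieces.\<close>
  have "H \<noteq> {}"
  proof
    assume "H = {}"
    then have GS: "G \<subseteq> \<Union>S" by (auto simp: H_def)
    have sub: "F \<subseteq> \<Union>((\<lambda>W. fst ` (G \<inter> W)) ` S)"
    proof
      fix x assume "x \<in> F"
      then obtain p W where "p \<in> G" "x = fst p" "W \<in> S" "p \<in> W" using G(2) GS by blast
      then show "x \<in> \<Union>((\<lambda>W. fst ` (G \<inter> W)) ` S)" by auto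
    qed
    then have "S \<noteq> {}" using F(2) by auto
    then have "packing_covered t (\<Union>((\<lambda>W. fst ` (G \<inter> W)) ` S))"
      using cS by (intro packing_covered_UN) (auto simp: S_def)
    then show False using packing_covered_mono[OF _ sub] notcov by blast
  qed
  define \<B> where "\<B> = {U \<in> \<B>0. bounded (fst ` (H \<inter> U)) \<and> H \<inter> U \<noteq> {}}"
  show ?thesis
  proof
    show "closed H" by fact
    show "H \<noteq> {}" by fact
    show "fst ` H \<subseteq> F" using G(2) by (auto simp: H_def)
    show "countable \<B>" using \<B>0(1) by (simp add: \<B>_def)
    show "bounded (fst ` (H \<inter> U)) \<and> H \<inter> U \<noteq> {} \<and> t < upper_box_dim (fst ` (H \<inter> U))" if "U \<in> \<B>" for U
    proof -
      have U: "U \<in> \<B>0" "bounded (fst ` (H \<inter> U))" "H \<inter> U \<noteq> {}" using that by (auto simp: \<B>_def)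
      \<comment> \<open>Otherwise \<open>absorb\<close> puts \<open>U\<close> among the deleted
        sets, and \<open>H \<inter> U\<close> would be empty.\<close>
      have "t < upper_box_dim (fst ` (H \<inter> U))"
      proof (rule ccontr)
        assume "\<not> ?thesis"
        then have "packing_covered t (fst ` (H \<inter> U))"
          using U by (intro packing_covered_if_upper_box_dim_le) auto
        then have "U \<in> S" using absorb U(1) by (simp add: S_def)
        then show False using U(3) by (auto simp: H_def)
      qed
      then show ?thesis using U by blast
    qed
    show "\<exists>U\<in>\<B>. U \<subseteq> W" if W: "open W" "W \<inter> H \<noteq> {}" for W
    proof -
      obtain p where p: "p \<in> W" "p \<in> H" using W(2) by auto
      \<comment> \<open>Cutting \<open>W\<close> down to a cylinder over a unit ball makes the
        projected piece bounded, as membership in \<open>\<B>\<close> demands.\<close>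
      have "open (W \<inter> (ball (fst p) 1 \<times> UNIV))" using W(1) by (intro open_Int open_Times) auto
      moreover have "p \<in> W \<inter> (ball (fst p) 1 \<times> UNIV)" using p by (simp add: mem_Times_iff)
      ultimately obtain U where U: "U \<in> \<B>0" "p \<in> U" "U \<subseteq> W \<inter> (ball (fst p) 1 \<times> UNIV)"
        using topological_basisE[OF \<B>0(2)] by metis
      have "fst ` (H \<inter> U) \<subseteq> ball (fst p) 1" using U(3) by auto
      then have "bounded (fst ` (H \<inter> U))" using bounded_ball bounded_subset by blast
      then have "U \<in> \<B>" using U p by (auto simp: \<B>_def)
      then show ?thesis using U(3) by blast
    qed
  qed
qed

text \<open>The preimages of a compact cover of the image form a closed cover of \<open>H\<close>.
  By Baire one of them contains a nonempty relatively open piece of \<open>H\<close>, hence a piece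
  from \<open>\<B>\<close>, and so the corresponding compact set has upper box dimension at least
  \<open>c\<close>.\<close>

lemma packing_dim_image_ge:
  fixes f :: "'a::euclidean_space \<Rightarrow> 'b::euclidean_space" and H :: "('a \<times> (nat \<Rightarrow> real)) set"
  assumes "closed H" "H \<noteq> {}" "fst ` H \<subseteq> F" "continuous_on UNIV f"
    and \<B>: "\<And>U. U \<in> \<B> \<Longrightarrow> H \<inter> U \<noteq> {} \<and> c \<le> upper_box_dim (f ` fst ` (H \<inter> U))"
    and sub: "\<And>W. open W \<Longrightarrow> W \<inter> H \<noteq> {} \<Longrightarrow> \<exists>U\<in>\<B>. U \<subseteq> W"
  shows "c \<le> packing_dim (f ` F)"
  unfolding packing_dim_def
proof (intro Inf_greatest)
  fix b assume "b \<in> {SUP j. upper_box_dim (K j) | K :: nat \<Rightarrow> 'b set.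
            (\<forall>j. compact (K j) \<and> K j \<noteq> {}) \<and> f ` F \<subseteq> (\<Union>j. K j)}"
  then obtain K :: "nat \<Rightarrow> 'b set" where K: "b = (SUP j. upper_box_dim (K j))" "\<And>j. compact (K j)"
    "f ` F \<subseteq> (\<Union>j. K j)" by blast
  have cf: "continuous_on UNIV (\<lambda>p :: 'a \<times> (nat \<Rightarrow> real). f (fst p))"
    using assms(4) by (rule continuous_on_compose2) (auto intro: continuous_on_fst continuous_on_id)
  have "closed ((\<lambda>p. f (fst p)) -` K j :: ('a \<times> (nat \<Rightarrow> real)) set)" for j
    using compact_imp_closed[OF K(2)] cf by (rule closed_vimage)
  moreover have "H \<subseteq> (\<Union>j. (\<lambda>p. f (fst p)) -` K j)"
  proof
    fix p assume "p \<in> H"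
    then have "f (fst p) \<in> f ` F" using assms(3) by auto
    then show "p \<in> (\<Union>j. (\<lambda>p. f (fst p)) -` K j)" using K(3) by auto
  qed
  ultimately obtain j W where W: "open W" "W \<inter> H \<noteq> {}" "W \<inter> H \<subseteq> (\<lambda>p. f (fst p)) -` K j"
    using Baire_closed_cover[OF assms(1,2), of "\<lambda>j. (\<lambda>p. f (fst p)) -` K j"] by metis
  obtain U where U: "U \<in> \<B>" "U \<subseteq> W" using sub[OF W(1,2)] by blast
  have "f ` fst ` (H \<inter> U) \<subseteq> K j" using U(2) W(3) by auto
  then have "upper_box_dim (f ` fst ` (H \<inter> U)) \<le> upper_box_dim (K j)"
    using compact_imp_bounded[OF K(2)] \<B>[OF U(1)] by (intro upper_box_dim_mono) auto
  then show "c \<le> b" unfolding K(1) using \<B>[OF U(1)] by (meson SUP_upper2 UNIV_I order_trans)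
qed

lemma packing_dim_nonneg:
  fixes F :: "'a::euclidean_space set"
  shows "0 \<le> packing_dim F"
  unfolding packing_dim_def
proof (intro Inf_greatest)
  fix b assume "b \<in> {SUP j. upper_box_dim (K j) | K :: nat \<Rightarrow> 'a set.
            (\<forall>j. compact (K j) \<and> K j \<noteq> {}) \<and> F \<subseteq> (\<Union>j. K j)}"
  then obtain K :: "nat \<Rightarrow> 'a set" where K: "b = (SUP j. upper_box_dim (K j))" "\<And>j. compact (K j) \<and> K j \<noteq> {}"
    by blast
  have "0 \<le> upper_box_dim (K 0)" using K(2)[of 0] by (intro upper_box_dim_nonneg compact_imp_bounded) auto
  then show "0 \<le> b" unfolding K(1) by (rule SUP_upper2[rotated]) simp
qed

subsection \<open>Packing dimensions of projections\<close>

text \<open>For each \<open>t < d\<close> the kernel consists of countably many basic pieces of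
  upper box dimension above \<open>t\<close>; almost every \<open>V\<close> is good for all of them
  at once, and the Baire argument passes this on to the projection of \<open>F\<close>.\<close>

lemma AE_packing_dim_projection_ge:
  fixes F :: "(real^'n) set"
  assumes \<gamma>: "invariant_grassmann_measure m \<gamma>" and m: "1 \<le> m" and F: "F \<in> sets borel" "F \<noteq> {}"
    and a: "assouad_dim F = ereal a" "real m \<le> a" and p: "packing_dim F = ereal d" "0 < d"
  shows "AE V in \<gamma>. ereal (real m / a * d) \<le> packing_dim (orth_proj V ` F)"
proof -
  have s: "sets \<gamma> = sets (grassmann_borel m)" using \<gamma> by (simp add: invariant_grassmann_measure_def)
  have sp: "space \<gamma> = grassmannian m"
    using sets_eq_imp_space_eq[OF s] by (simp add: grassmann_borel_def)
  have step: "AE V in \<gamma>. ereal (real m / a * t) \<le> packing_dim (orth_proj V ` F)" if t: "0 \<le> t" "t < d" for t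
  proof -
    have "ereal t < packing_dim F" using p(1) t(2) by simp
    then obtain H :: "((real^'n) \<times> (nat \<Rightarrow> real)) set" and \<B> where H:
      "closed H" "H \<noteq> {}" "fst ` H \<subseteq> F" "countable \<B>"
      "\<And>U. U \<in> \<B> \<Longrightarrow> bounded (fst ` (H \<inter> U)) \<and> H \<inter> U \<noteq> {} \<and> ereal t < upper_box_dim (fst ` (H \<inter> U))"
      "\<And>W. open W \<Longrightarrow> W \<inter> H \<noteq> {} \<Longrightarrow> \<exists>U\<in>\<B>. U \<subseteq> W"
      using exists_packing_kernel[OF F] by metis
    have "AE V in \<gamma>. ereal (real m / a * t) \<le> upper_box_dim (orth_proj V ` fst ` (H \<inter> U))" if U: "U \<in> \<B>" for U
    proof -
      have *: "bounded (fst ` (H \<inter> U))" "fst ` (H \<inter> U) \<noteq> {}" "fst ` (H \<inter> U) \<subseteq> F"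
        using H(5)[OF U] H(3) by auto
      have "ereal t \<le> upper_box_dim (fst ` (H \<inter> U))" using H(5)[OF U] less_imp_le by blast
      then show ?thesis
        using AE_box_dim_projection_ge[OF \<gamma> m * a] t(1) by (elim eventually_mono) blast
    qed
    then have "AE V in \<gamma>. \<forall>U\<in>\<B>. ereal (real m / a * t) \<le> upper_box_dim (orth_proj V ` fst ` (H \<inter> U))"
      using H(4) by (simp add: AE_ball_countable)
    then show ?thesis using AE_space
    proof eventually_elim
      case (elim V)
      have "subspace V" using elim(2) by (simp add: sp grassmannian_def)
      then have "continuous_on UNIV (orth_proj V)"
        using linear_orth_proj by (intro linear_continuous_on) (simp add: linear_conv_bounded_linear)
      then show ?case using H(5,6) elim(1) by (intro packing_dim_image_ge[OF H(1-3), of _ \<B>]) auto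
    qed
  qed
  \<comment> \<open>A sequence from 0 up to \<open>d\<close>, each term strictly below
    \<open>d\<close>, so that one null set serves the limit.\<close>
  define t where "t j = d * (1 - 1 / real (Suc j))" for j
  have "0 \<le> t j \<and> t j < d" for j
  proof -
    have "1 / real (Suc j) \<le> 1" "0 < 1 / real (Suc j)" by simp_all
    then have "0 \<le> d * (1 - 1 / real (Suc j))" "d * (1 - 1 / real (Suc j)) < d * 1"
      using p(2) by (simp_all only: mult_less_cancel_left_pos zero_le_mult_iff) linarith+
    then show ?thesis by (simp add: t_def)
  qed
  then have AE_t: "AE V in \<gamma>. \<forall>j. ereal (real m / a * t j) \<le> packing_dim (orth_proj V ` F)"
    using step by (simp add: AE_all_countable)
  have "t \<longlonglongrightarrow> d * (1 - 0)"
    unfolding t_def by (intro tendsto_mult tendsto_diff tendsto_const LIMSEQ_Suc[OF lim_1_over_n])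
  then have lim: "(\<lambda>j. ereal (real m / a * t j)) \<longlonglongrightarrow> ereal (real m / a * d)"
    by (intro tendsto_ereal tendsto_mult tendsto_const) simp
  from AE_t show ?thesis
  proof eventually_elim
    case (elim V)
    then show ?case by (intro LIMSEQ_le_const2[OF lim]) auto
  qed
qed

section \<open>Comparison with the stated thresholds\<close>

text \<open>The projection bound \<open>m d / a\<close> dominates \<open>d - (a - m) d / m\<close> because \<open>(a - m)\<^sup>2 \<ge> 0\<close>.\<close>

lemma projection_threshold_real:
  fixes m n a d :: real
  assumes "1 \<le> m" "m < n" "0 \<le> d" "m \<le> a"
    and "a < ((m * n + 2 * d * (n - m)) * m) / (m * n + d * (n - m))"
  shows "0 < d" "d - (a - m) * d / m \<le> m / a * d"
    "d / (1 + (1 / m - 1 / n) * d) < d - (a - m) * d / m"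
proof -
  \<comment> \<open>For \<open>d = 0\<close> the upper bound on \<open>a\<close> would read
    \<open>a < m\<close>.\<close>
  show d: "0 < d"
  proof (rule ccontr)
    assume "\<not> 0 < d"
    then have "d = 0" using assms(3) by simp
    then show False using assms by simp
  qed
  have a0: "0 < a" using assms(1,4) by linarith
  have "0 \<le> (a - m)\<^sup>2" by simp
  then have "a * (2 * m - a) \<le> m * m" by (simp add: power2_eq_square algebra_simps)
  then have "(2 * m - a) / m \<le> m / a" using a0 assms(1) by (simp add: divide_simps mult.commute)
  then have "(2 * m - a) / m * d \<le> m / a * d" using d by (intro mult_right_mono) auto
  moreover have eq: "d - (a - m) * d / m = (2 * m - a) / m * d" using assms(1) by (simp add: field_simps)
  ultimately show "d - (a - m) * d / m \<le> m / a * d" by simp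
  \<comment> \<open>The denominator in the hypothesis on \<open>a\<close>. Its numerator is
    \<open>(2 * q - m * n) * m\<close>, so the hypothesis says
    \<open>m * n / q < (2 * m - a) / m\<close>, which is the claim divided by
    \<open>d\<close>.\<close>
  define q where "q = m * n + d * (n - m)"
  have q: "0 < q" unfolding q_def using assms d by (intro add_pos_nonneg mult_pos_pos mult_nonneg_nonneg) auto
  have "1 + (1 / m - 1 / n) * d = q / (m * n)" using assms by (simp add: q_def field_simps)
  then have lhs: "d / (1 + (1 / m - 1 / n) * d) = m * n / q * d" by simp
  have "a * q < (2 * q - m * n) * m" using assms(5) q unfolding q_def by (simp add: pos_less_divide_eq algebra_simps)
  then have "m * n / q < (2 * m - a) / m" using q assms(1) by (simp add: divide_simps algebra_simps)
  then show "d / (1 + (1 / m - 1 / n) * d) < d - (a - m) * d / m"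
    unfolding lhs eq using d by (intro mult_strict_right_mono)
qed

text \<open>The hypotheses force both extended reals to be finite, so the real inequalities apply.
  With \<open>y\<close> arbitrary, the lemma serves all three notions of dimension.\<close>

lemma projection_threshold:
  fixes x A :: ereal and m n :: nat
  assumes m: "1 \<le> m" "m < n" and x: "0 \<le> x" "x \<le> m" and A: "max (ereal m) x \<le> A"
    and less: "A < ((ereal m * n + 2 * x * (real n - real m)) * m) / (ereal m * n + x * (real n - real m))"
  obtains d a where "x = ereal d" "A = ereal a" "0 < d" "real m \<le> a"
    "\<And>y. ereal (real m / a * d) \<le> y \<Longrightarrow> y \<ge> x - (A - m) * x / m \<and>
       x - (A - m) * x / m > x / (1 + (1 / real m - 1 / real n) * x)"
proof -
  obtain d where d: "x = ereal d" "0 \<le> d" using x by (cases x) auto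
  have q: "0 < real m * real n + d * (real n - real m)"
    using m d(2) by (intro add_pos_nonneg mult_pos_pos mult_nonneg_nonneg) auto
  have "A < ereal ((real m * real n + 2 * d * (real n - real m)) * real m / (real m * real n + d * (real n - real m)))"
    using less q unfolding d(1) by simp
  moreover have "ereal m \<le> A" using A by simp
  ultimately obtain a where a: "A = ereal a" "real m \<le> a"
    "a < (real m * real n + 2 * d * (real n - real m)) * real m / (real m * real n + d * (real n - real m))"
    by (cases A) auto
  note thr = projection_threshold_real[OF _ _ d(2) a(2,3)]
  \<comment> \<open>A nonzero denominator lets the extended real quotient be computed as a real
    one.\<close>
  have pos: "1 + (1 / real m - 1 / real n) * d \<noteq> 0"
  proof -
    have "0 \<le> 1 / real m - 1 / real n" using m by (simp add: frac_le)
    then have "0 \<le> (1 / real m - 1 / real n) * d" using d(2) by (rule mult_nonneg_nonneg)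
    then show ?thesis by linarith
  qed
  show ?thesis
  proof (rule that[OF d(1) a(1)])
    show "0 < d" "real m \<le> a" using thr m a(2) by auto
    fix y assume y: "ereal (real m / a * d) \<le> y"
    have "x - (A - m) * x / m = ereal (d - (a - real m) * d / real m)" using m by (simp add: d(1) a(1))
    moreover have "x / (1 + (1 / real m - 1 / real n) * x) = ereal (d / (1 + (1 / real m - 1 / real n) * d))"
      using pos by (simp add: d(1) one_ereal_def)
    moreover have "ereal (d - (a - real m) * d / real m) \<le> ereal (real m / a * d)" using thr(2) m by simp
    moreover have "d / (1 + (1 / real m - 1 / real n) * d) < d - (a - real m) * d / real m" using thr(3) m by simp
    ultimately show "y \<ge> x - (A - m) * x / m \<and>
       x - (A - m) * x / m > x / (1 + (1 / real m - 1 / real n) * x)"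
      using y by (metis less_ereal.simps(1) order_trans)
  qed
qed

section \<open>The result for upper box, lower box and packing dimension\<close>

theorem corollary1p5:
  fixes F :: "(real^'n) set" and m :: nat and \<gamma> :: "(real^'n) set measure"
  defines "n \<equiv> CARD('n)"
  assumes "1 \<le> m" and "m < n"
    and "invariant_grassmann_measure m \<gamma>"
    and "F \<noteq> {}"
  shows "(bounded F \<and> upper_box_dim F \<le> m \<and>
      max (ereal m) (upper_box_dim F) \<le> assouad_dim F \<and>
      assouad_dim F <
        ((ereal m * n + 2 * upper_box_dim F * (real n - real m)) * m) /
        (ereal m * n + upper_box_dim F * (real n - real m)) \<longrightarrow>
      (AE V in \<gamma>.
        upper_box_dim (orth_proj V ` F) \<ge>
          upper_box_dim F - (assouad_dim F - m) * upper_box_dim F / m \<and>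
        upper_box_dim F - (assouad_dim F - m) * upper_box_dim F / m >
          upper_box_dim F / (1 + (1 / real m - 1 / real n) * upper_box_dim F)))
    \<and>
     (bounded F \<and> lower_box_dim F \<le> m \<and>
      max (ereal m) (lower_box_dim F) \<le> assouad_dim F \<and>
      assouad_dim F <
        ((ereal m * n + 2 * lower_box_dim F * (real n - real m)) * m) /
        (ereal m * n + lower_box_dim F * (real n - real m)) \<longrightarrow>
      (AE V in \<gamma>.
        lower_box_dim (orth_proj V ` F) \<ge>
          lower_box_dim F - (assouad_dim F - m) * lower_box_dim F / m \<and>
        lower_box_dim F - (assouad_dim F - m) * lower_box_dim F / m >
          lower_box_dim F / (1 + (1 / real m - 1 / real n) * lower_box_dim F)))
    \<and>
     (F \<in> sets borel \<and> packing_dim F \<le> m \<and>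
      max (ereal m) (packing_dim F) \<le> assouad_dim F \<and>
      assouad_dim F <
        ((ereal m * n + 2 * packing_dim F * (real n - real m)) * m) /
        (ereal m * n + packing_dim F * (real n - real m)) \<longrightarrow>
      (AE V in \<gamma>.
        packing_dim (orth_proj V ` F) \<ge>
          packing_dim F - (assouad_dim F - m) * packing_dim F / m \<and>
        packing_dim F - (assouad_dim F - m) * packing_dim F / m >
          packing_dim F / (1 + (1 / real m - 1 / real n) * packing_dim F)))"
proof (intro conjI impI; elim conjE)
  assume "bounded F" and h: "upper_box_dim F \<le> m" "max (ereal m) (upper_box_dim F) \<le> assouad_dim F"
    "assouad_dim F < ((ereal m * n + 2 * upper_box_dim F * (real n - real m)) * m) /
        (ereal m * n + upper_box_dim F * (real n - real m))"
  \<comment> \<open>In each of the three parts \<open>concl\<close> reduces both claimed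
    inequalities to the lower bound \<open>m * d / a\<close> for the dimension of the
    projection.\<close>
  obtain d a where da: "upper_box_dim F = ereal d" "assouad_dim F = ereal a" "0 < d" "real m \<le> a"
    and concl: "\<And>y. ereal (real m / a * d) \<le> y \<Longrightarrow>
      y \<ge> upper_box_dim F - (assouad_dim F - m) * upper_box_dim F / m \<and>
      upper_box_dim F - (assouad_dim F - m) * upper_box_dim F / m >
        upper_box_dim F / (1 + (1 / real m - 1 / real n) * upper_box_dim F)"
    using projection_threshold[OF assms(2,3) upper_box_dim_nonneg[OF \<open>bounded F\<close> assms(5)] h] by blast
  show "AE V in \<gamma>.
        upper_box_dim (orth_proj V ` F) \<ge>
          upper_box_dim F - (assouad_dim F - m) * upper_box_dim F / m \<and>
        upper_box_dim F - (assouad_dim F - m) * upper_box_dim F / m >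
          upper_box_dim F / (1 + (1 / real m - 1 / real n) * upper_box_dim F)"
    using AE_box_dim_projection_ge[OF assms(4,2) \<open>bounded F\<close> assms(5) subset_refl da(2,4)]
  proof eventually_elim
    case (elim V)
    have "ereal (real m / a * d) \<le> upper_box_dim (orth_proj V ` F)" using elim da(1,3) by auto
    then show ?case by (rule concl)
  qed
next
  assume "bounded F" and h: "lower_box_dim F \<le> m" "max (ereal m) (lower_box_dim F) \<le> assouad_dim F"
    "assouad_dim F < ((ereal m * n + 2 * lower_box_dim F * (real n - real m)) * m) /
        (ereal m * n + lower_box_dim F * (real n - real m))"
  obtain d a where da: "lower_box_dim F = ereal d" "assouad_dim F = ereal a" "0 < d" "real m \<le> a"
    and concl: "\<And>y. ereal (real m / a * d) \<le> y \<Longrightarrow>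
      y \<ge> lower_box_dim F - (assouad_dim F - m) * lower_box_dim F / m \<and>
      lower_box_dim F - (assouad_dim F - m) * lower_box_dim F / m >
        lower_box_dim F / (1 + (1 / real m - 1 / real n) * lower_box_dim F)"
    using projection_threshold[OF assms(2,3) lower_box_dim_nonneg[OF \<open>bounded F\<close> assms(5)] h] by blast
  show "AE V in \<gamma>.
        lower_box_dim (orth_proj V ` F) \<ge>
          lower_box_dim F - (assouad_dim F - m) * lower_box_dim F / m \<and>
        lower_box_dim F - (assouad_dim F - m) * lower_box_dim F / m >
          lower_box_dim F / (1 + (1 / real m - 1 / real n) * lower_box_dim F)"
    using AE_box_dim_projection_ge[OF assms(4,2) \<open>bounded F\<close> assms(5) subset_refl da(2,4)]
  proof eventually_elim
    case (elim V)
    have "ereal (real m / a * d) \<le> lower_box_dim (orth_proj V ` F)" using elim da(1,3) by auto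
    then show ?case by (rule concl)
  qed
next
  assume "F \<in> sets borel" and h: "packing_dim F \<le> m" "max (ereal m) (packing_dim F) \<le> assouad_dim F"
    "assouad_dim F < ((ereal m * n + 2 * packing_dim F * (real n - real m)) * m) /
        (ereal m * n + packing_dim F * (real n - real m))"
  obtain d a where da: "packing_dim F = ereal d" "assouad_dim F = ereal a" "0 < d" "real m \<le> a"
    and concl: "\<And>y. ereal (real m / a * d) \<le> y \<Longrightarrow>
      y \<ge> packing_dim F - (assouad_dim F - m) * packing_dim F / m \<and>
      packing_dim F - (assouad_dim F - m) * packing_dim F / m >
        packing_dim F / (1 + (1 / real m - 1 / real n) * packing_dim F)"
    using projection_threshold[OF assms(2,3) packing_dim_nonneg h] by blast
  show "AE V in \<gamma>.
        packing_dim (orth_proj V ` F) \<ge>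
          packing_dim F - (assouad_dim F - m) * packing_dim F / m \<and>
        packing_dim F - (assouad_dim F - m) * packing_dim F / m >
          packing_dim F / (1 + (1 / real m - 1 / real n) * packing_dim F)"
    using AE_packing_dim_projection_ge[OF assms(4,2) \<open>F \<in> sets borel\<close> assms(5) da(2,4,1,3)]
    by eventually_elim (rule concl)
qed

end
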